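(* Let $\mathcal{S}$ be the class of Świątkowski functions. Then (i) $\mathcal{B}_1(\mathcal{S})=\mathfrak{S}$; (ii) $\mathcal{B}_\alpha(\mathcal{S})$ equals the class of all functions $\mathbb{R}\to\mathbb{R}$ with the Baire property for every ordinal $1<\alpha<\omega_1$. Hence the Baire order of $\mathcal{S}$ equals $2$.
   Context: $\mathrm{C}(f)$ denotes the set of continuity points of $f$. $f$ is a Świątkowski function if for all $a<b$ with $f(a)\ne f(b)$ there is $x\in(a,b)\cap\mathrm{C}(f)$ with $f(x)$ strictly between $f(a)$ and $f(b)$. For a family $\mathcal{F}$ of functions $\mathbb{R}\to\mathbb{R}$, $\mathrm{LIM}(\mathcal{F})$ is the family of pointwise limits of sequences from $\mathcal{F}$; $\mathcal{B}_0(\mathcal{F})=\mathcal{F}$ and $\mathcal{B}_\alpha(\mathcal{F})=\mathrm{LIM}(\bigcup_{\beta<\alpha}\mathcal{B}_\beta(\mathcal{F}))$ for $\alpha>0$; the Baire order of $\mathcal{F}$ is the least $\alpha\le\omega_1$ with $\mathcal{B}_\alpha(\mathcal{F})=\bigcup_{\beta<\alpha}\mathcal{B}_\beta(\mathcal{F})$. A function has the Baire property if preimages of open sets are of the form $O\triangle M$ with $O$ open and $M$ meager; a set is residual if its complement is meager. For $a,b\in\mathbb{R}$, $I(a,b)$ is the open interval with end-points $a,b$. For $A\subset\mathbb{R}$, an interval $J$ and $\varepsilon\ge0$, $f$ satisfies $S(J,A,\varepsilon)$ if for all $a,b\in J$ with $f(a)<f(b)$ there exists $x\in A\cap I(a,b)$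 with $f(x)\in(f(a)-\varepsilon,f(b)+\varepsilon)$. $f$ satisfies $S(A,\varepsilon)$ if the union of all open intervals $J$ for which $S(J,A,\varepsilon)$ holds is dense in $\mathbb{R}$. $\mathfrak{S}$ is the class of functions with the Baire property satisfying $S(A,\varepsilon)$ for all residual $A$ and all $\varepsilon>0$.
   Formalization: With the Baire order defined as the least α with B_α equal to the union of earlier stages, its value would be 3, not 2; the formal version instead states stabilization at 2: B_1 ≠ B_0, B_2 ≠ B_1 and B_3 = B_2. *)

theory Defs
  imports "HOL-Analysis.Analysis"
begin

definition nowhere_dense :: "real set \<Rightarrow> bool" where
  "nowhere_dense S \<longleftrightarrow> interior (closure S) = {}"

definition meager :: "real set \<Rightarrow> bool" where
  "meager M \<longleftrightarrow> (\<exists>N :: nat \<Rightarrow> real set. (\<forall>n. nowhere_dense (N n)) \<and> M \<subseteq> (\<Union>n. N n))"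

definition residual :: "real set \<Rightarrow> bool" where
  "residual A \<longleftrightarrow> meager (- A)"

definition has_Baire_property :: "(real \<Rightarrow> real) \<Rightarrow> bool" where
  "has_Baire_property f \<longleftrightarrow>
     (\<forall>U. open U \<longrightarrow> (\<exists>V M. open V \<and> meager M \<and> f -` U = (V - M) \<union> (M - V)))"

definition swiatkowski :: "(real \<Rightarrow> real) \<Rightarrow> bool" where
  "swiatkowski f \<longleftrightarrow>
     (\<forall>a b. a < b \<and> f a \<noteq> f b \<longrightarrow>
        (\<exists>x \<in> {a<..<b}. isCont f x \<and> min (f a) (f b) < f x \<and> f x < max (f a) (f b)))"

definition Swiat_class :: "(real \<Rightarrow> real) set" where
  "Swiat_class = {f. swiatkowski f}"

definition LIMf :: "(real \<Rightarrow> real) set \<Rightarrow> (real \<Rightarrow> real) set" where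
  "LIMf F = {g. \<exists>fs :: nat \<Rightarrow> real \<Rightarrow> real. (\<forall>n. fs n \<in> F) \<and> (\<forall>x. (\<lambda>n. fs n x) \<longlonglongrightarrow> g x)}"

text \<open>Baire hierarchy along a well-order r: the stage at an element a of Field r
  corresponds to the ordinal which is the order type of the strict predecessors of a.\<close>
definition Bhier :: "(real \<Rightarrow> real) set \<Rightarrow> ('i \<times> 'i) set \<Rightarrow> 'i \<Rightarrow> (real \<Rightarrow> real) set" where
  "Bhier F r = wfrec (r - Id)
     (\<lambda>B a. if (\<forall>b. (b, a) \<notin> r - Id) then F
            else LIMf (\<Union>{B b | b. (b, a) \<in> r - Id}))"

fun Bnat :: "(real \<Rightarrow> real) set \<Rightarrow> nat \<Rightarrow> (real \<Rightarrow> real) set" where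
  "Bnat F 0 = F"
| "Bnat F (Suc n) = LIMf (\<Union>k\<le>n. Bnat F k)"

definition open_interval :: "real \<Rightarrow> real \<Rightarrow> real set" where
  "open_interval a b = {min a b <..< max a b}"

definition S_J :: "real set \<Rightarrow> real set \<Rightarrow> real \<Rightarrow> (real \<Rightarrow> real) \<Rightarrow> bool" where
  "S_J J A \<epsilon> f \<longleftrightarrow>
     (\<forall>a \<in> J. \<forall>b \<in> J. f a < f b \<longrightarrow>
        (\<exists>x \<in> A \<inter> open_interval a b. f a - \<epsilon> < f x \<and> f x < f b + \<epsilon>))"

definition is_open_interval :: "real set \<Rightarrow> bool" where
  "is_open_interval J \<longleftrightarrow> open J \<and> is_interval J \<and> J \<noteq> {}"

definition S_prop :: "real set \<Rightarrow> real \<Rightarrow> (real \<Rightarrow> real) \<Rightarrow> bool" where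
  "S_prop A \<epsilon> f \<longleftrightarrow>
     closure (\<Union>{J. is_open_interval J \<and> S_J J A \<epsilon> f}) = UNIV"

definition frakS :: "(real \<Rightarrow> real) set" where
  "frakS = {f. has_Baire_property f \<and> (\<forall>A \<epsilon>. residual A \<and> \<epsilon> > 0 \<longrightarrow> S_prop A \<epsilon> f)}"

end

theory Submission
  imports Defs
begin

text \<open>
  A function has the Baire property iff its restriction to some residual set is continuous.
  Restricted to such a set, a pointwise convergent sequence converges uniformly up to \<open>\<epsilon>\<close> on densely
  many intervals; this closes the Baire property under limits and puts limits of
  Swiatkowski functions into \<open>\<SS>\<close>.

  Conversely, let \<open>f\<close> be continuous on a residual set \<open>R\<close>. Choose closed nowhere dense sets
  \<open>F 0 \<subseteq> F 1 \<subseteq> \<dots>\<close> covering the complement of \<open>R\<close> such that \<open>f\<close> oscillates by at most \<open>2^-n\<close> on \<open>R\<close>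
  inside each gap of \<open>F n\<close>. Replacing \<open>f\<close> on each gap of \<open>F n\<close> by a value that it takes there on \<open>R\<close>
  gives members of \<open>\<SS>\<close> converging to \<open>f\<close>. If \<open>f\<close> itself belongs to \<open>\<SS>\<close>, the gaps can moreover be
  taken short and such that \<open>S(J, R, 2^-n)\<close> holds on each of them; replacing the constants by functions
  that oscillate at both ends of the gap makes the approximants Swiatkowski functions, and the
  condition \<open>S(J, R, 2^-n)\<close> is what keeps the amplitude of these oscillations small.
\<close>

subsection \<open>Meager sets and the Baire property\<close>

text \<open>Later arguments shrink an interval step by step, so nowhere density is wanted in terms
  of subintervals.\<close>

lemma nowhere_dense_iff:
  "nowhere_dense S \<longleftrightarrow>
    (\<forall>a b. a < b \<longrightarrow> (\<exists>c d. a \<le> c \<and> c < d \<and> d \<le> b \<and> {c<..<d} \<inter> S = {}))"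
  (is "_ \<longleftrightarrow> ?R")
proof
  assume nd: "nowhere_dense S"
  show ?R
  proof (intro allI impI)
    fix a b :: real assume "a < b"
    have "\<not> {a<..<b} \<subseteq> closure S"
    proof
      assume "{a<..<b} \<subseteq> closure S"
      then have "{a<..<b} \<subseteq> interior (closure S)"
        by (simp add: interior_maximal)
      with nd \<open>a < b\<close> show False
        by (auto simp: nowhere_dense_def)
    qed
    then obtain x where x: "a < x" "x < b" "x \<notin> closure S"
      by (meson greaterThanLessThan_iff subsetI)
    then obtain e where "e > 0" "ball x e \<subseteq> - closure S"
      using openE[of "- closure S" x] by blast
    then have e: "e > 0" "ball x e \<inter> S = {}"
      using closure_subset by blast+
    have "{max a (x - e)<..<min b (x + e)} \<subseteq> ball x e"
      by (auto simp: dist_real_def)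
    with e x show "\<exists>c d. a \<le> c \<and> c < d \<and> d \<le> b \<and> {c<..<d} \<inter> S = {}"
      by (intro exI[of _ "max a (x - e)"] exI[of _ "min b (x + e)"]) auto
  qed
next
  assume R: ?R
  show "nowhere_dense S"
    unfolding nowhere_dense_def
  proof (rule ccontr)
    assume "interior (closure S) \<noteq> {}"
    then obtain x where "x \<in> interior (closure S)" by auto
    then obtain e where e: "e > 0" "ball x e \<subseteq> closure S"
      by (meson mem_interior)
    obtain c d where cd: "x - e \<le> c" "c < d" "d \<le> x + e" "{c<..<d} \<inter> S = {}"
      using R[rule_format, of "x - e" "x + e"] e by auto
    have "(c + d) / 2 \<in> ball x e"
      using cd by (auto simp: dist_real_def abs_if field_simps)
    with e have "(c + d) / 2 \<in> closure S" by blast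
    moreover have "{c<..<d} \<inter> closure S = {}"
      using cd(4) open_Int_closure_eq_empty[of "{c<..<d}" S] by auto
    moreover have "(c + d) / 2 \<in> {c<..<d}" using cd(2) by simp
    ultimately show False by blast
  qed
qed

lemma meager_subset: "meager M \<Longrightarrow> M' \<subseteq> M \<Longrightarrow> meager M'"
  unfolding meager_def by (meson order_trans)

lemma nowhere_dense_imp_meager: "nowhere_dense S \<Longrightarrow> meager S"
  unfolding meager_def by (rule exI[of _ "\<lambda>_. S"]) auto

lemma meager_UN:
  fixes M :: "nat \<Rightarrow> real set"
  assumes "\<And>n. meager (M n)"
  shows "meager (\<Union>n. M n)"
proof -
  have "\<forall>n. \<exists>N. (\<forall>k::nat. nowhere_dense (N k)) \<and> M n \<subseteq> (\<Union>k. N k)"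
    using assms by (simp add: meager_def)
  from choice[OF this] obtain N
    where N: "\<And>n k::nat. nowhere_dense (N n k)" "\<And>n. M n \<subseteq> (\<Union>k. N n k)"
    by blast
  have "M n \<subseteq> (\<Union>i. case_prod N (prod_decode i))" for n
  proof
    fix x assume "x \<in> M n"
    then obtain k where "x \<in> N n k" using N(2) by blast
    then have "x \<in> case_prod N (prod_decode (prod_encode (n, k)))" by simp
    then show "x \<in> (\<Union>i. case_prod N (prod_decode i))" by (rule UN_I[OF UNIV_I])
  qed
  then show ?thesis
    unfolding meager_def using N(1)
    by (intro exI[of _ "\<lambda>i. case_prod N (prod_decode i)"]) (auto split: prod.split)
qed

lemma residual_mono: "residual R \<Longrightarrow> R \<subseteq> R' \<Longrightarrow> residual R'"
  unfolding residual_def by (erule meager_subset) auto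

lemma residual_INT: "(\<And>n::nat. residual (R n)) \<Longrightarrow> residual (\<Inter>n. R n)"
  using meager_UN[of "\<lambda>n. - R n"] by (simp add: residual_def)

lemma residual_Int:
  assumes "residual R" "residual R'"
  shows "residual (R \<inter> R')"
  by (rule residual_mono[OF residual_INT[of "\<lambda>n. if n = 0 then R else R'"]])
     (use assms in \<open>auto split: if_splits\<close>)

lemma residual_cover:
  assumes "residual R"
  shows "\<exists>N :: nat \<Rightarrow> real set. (\<forall>n. nowhere_dense (N n)) \<and> - R \<subseteq> (\<Union>n. N n)"
  using assms by (simp add: residual_def meager_def)

text \<open>The Baire category theorem, applied to the complements of the closures of the sets
  covering \<open>- R\<close>.\<close>

lemma residual_dense:
  assumes "residual R" "a < b"
  shows "\<exists>x\<in>R. a < x \<and> x < b"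
proof -
  from residual_cover[OF assms(1)] obtain N :: "nat \<Rightarrow> real set" where N: "\<forall>n. nowhere_dense (N n)" "- R \<subseteq> (\<Union>n. N n)"
    by (elim exE conjE)
  have "UNIV \<subseteq> closure (\<Inter>n. - closure (N n))"
  proof (rule Baire[OF closed_UNIV])
    fix T assume "T \<in> range (\<lambda>n. - closure (N n))"
    then obtain n where "T = - closure (N n)" by auto
    with N(1)[rule_format, of n] show "openin (top_of_set UNIV) T \<and> UNIV \<subseteq> closure T"
      by (auto simp: closure_complement nowhere_dense_def)
  qed simp
  then have "(a + b) / 2 \<in> closure (\<Inter>n. - closure (N n))" by blast
  moreover have "(a + b) / 2 \<in> {a<..<b}" using assms(2) by simp
  ultimately have "{a<..<b} \<inter> (\<Inter>n. - closure (N n)) \<noteq> {}"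
    using open_Int_closure_eq_empty[OF open_greaterThanLessThan, of a b "\<Inter>n. - closure (N n)"]
    by blast
  then obtain x where x: "a < x" "x < b" "\<forall>n. x \<notin> closure (N n)" by auto
  then have "x \<in> R" using N(2) closure_subset by blast
  with x show ?thesis by blast
qed

lemma residual_open:
  assumes "open G" "\<And>a b. a < b \<Longrightarrow> \<exists>x\<in>G. a < x \<and> x < b"
  shows "residual G"
proof -
  have "nowhere_dense (- G)"
    unfolding nowhere_dense_iff
  proof (intro allI impI)
    fix a b :: real assume "a < b"
    then obtain x where x: "x \<in> G" "a < x" "x < b" using assms by blast
    then obtain e where e: "e > 0" "ball x e \<subseteq> G" using assms(1) openE by blast
    have "{max a (x - e)<..<min b (x + e)} \<subseteq> ball x e"
      by (auto simp: dist_real_def)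
    with e x show "\<exists>c d. a \<le> c \<and> c < d \<and> d \<le> b \<and> {c<..<d} \<inter> - G = {}"
      by (intro exI[of _ "max a (x - e)"] exI[of _ "min b (x + e)"]) auto
  qed
  then show ?thesis by (simp add: residual_def nowhere_dense_imp_meager)
qed

lemma residual_countable_compl:
  assumes "countable S"
  shows "residual (- S)"
proof -
  \<comment> \<open>If \<open>S\<close> is empty, \<open>from_nat_into S n\<close> is an arbitrary
    point; removing it is harmless because only an inclusion in \<open>- S\<close> is
    needed.\<close>
  have "residual (- (from_nat_into S ` {n}))" for n
  proof (rule residual_open)
    fix a b :: real assume "a < b"
    then obtain x y where "a < x" "x < y" "y < b" by (meson dense)
    then show "\<exists>x\<in>- (from_nat_into S ` {n}). a < x \<and> x < b"
      by (cases "x = from_nat_into S n") (auto intro: bexI[of _ x] bexI[of _ y])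
  qed auto
  then have "residual (\<Inter>n. - (from_nat_into S ` {n}))" by (rule residual_INT)
  then show ?thesis
    by (rule residual_mono) (use assms in \<open>auto dest: from_nat_into_surj\<close>)
qed

text \<open>Forward: for a countable base \<open>B n\<close>, each preimage is open up to a meager
  \<open>M n\<close>; discarding all \<open>M n\<close> leaves a residual set on which preimages of
  open sets are relatively open. Backward: a preimage and the open set tracing it on
  \<open>R\<close> differ only inside \<open>- R\<close>.\<close>

lemma has_Baire_property_iff:
  "has_Baire_property f \<longleftrightarrow> (\<exists>R. residual R \<and> continuous_on R f)"
proof
  assume bp: "has_Baire_property f"
  obtain B :: "nat \<Rightarrow> real set" where B: "\<And>n. open (B n)" "\<And>S. open S \<Longrightarrow> \<exists>k. S = \<Union>{B i |i. i \<in> k}"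
    by (rule univ_second_countable_sequence) blast
  have "\<forall>n. \<exists>V M. open V \<and> meager M \<and> f -` B n = (V - M) \<union> (M - V)"
    using bp B(1) unfolding has_Baire_property_def by blast
  then obtain V M where VM: "\<And>n. open (V n)" "\<And>n. meager (M n)" "\<And>n. f -` B n = (V n - M n) \<union> (M n - V n)"
    unfolding choice_iff by blast
  define R where "R = - (\<Union>n. M n)"
  have "residual R"
    using meager_UN[of M] VM(2) by (simp add: R_def residual_def)
  moreover have "continuous_on R f"
    unfolding continuous_on_open_invariant
  proof (intro allI impI)
    fix U :: "real set" assume "open U"
    then obtain k where k: "U = \<Union>{B i |i. i \<in> k}" using B(2) by blast
    have "(\<Union>i\<in>k. V i) \<inter> R = f -` U \<inter> R"
      unfolding k using VM(3) by (auto simp: R_def vimage_Union) blast+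
    moreover have "open (\<Union>i\<in>k. V i)" using VM(1) by auto
    ultimately show "\<exists>A. open A \<and> A \<inter> R = f -` U \<inter> R" by blast
  qed
  ultimately show "\<exists>R. residual R \<and> continuous_on R f" by blast
next
  assume "\<exists>R. residual R \<and> continuous_on R f"
  then obtain R where R: "residual R" "continuous_on R f" by blast
  show "has_Baire_property f"
    unfolding has_Baire_property_def
  proof (intro allI impI)
    fix U :: "real set" assume "open U"
    then obtain V where V: "open V" "V \<inter> R = f -` U \<inter> R"
      using R(2) unfolding continuous_on_open_invariant by blast
    define M where "M = (f -` U - V) \<union> (V - f -` U)"
    have "meager M"
      by (rule meager_subset[of "- R"]) (use R V in \<open>auto simp: residual_def M_def\<close>)
    moreover have "f -` U = (V - M) \<union> (M - V)" by (auto simp: M_def)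
    ultimately show "\<exists>V M. open V \<and> meager M \<and> f -` U = (V - M) \<union> (M - V)"
      using V(1) by blast
  qed
qed

section \<open>Small oscillation and uniform convergence on residual sets\<close>

lemma continuous_on_residual_oscillation:
  fixes f :: "real \<Rightarrow> real"
  assumes "residual R" "continuous_on R f" "e > 0" "a < b"
  shows "\<exists>l u. a \<le> l \<and> l < u \<and> u \<le> b \<and> (\<forall>x\<in>R \<inter> {l<..<u}. \<forall>y\<in>R \<inter> {l<..<u}. \<bar>f x - f y\<bar> \<le> e)"
proof -
  obtain c where c: "c \<in> R" "a < c" "c < b" using residual_dense assms by blast
  then obtain d where d: "d > 0" "\<And>x. x \<in> R \<Longrightarrow> \<bar>x - c\<bar> < d \<Longrightarrow> \<bar>f x - f c\<bar> < e / 2"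
    using assms(2,3) unfolding continuous_on_iff dist_real_def by (metis half_gt_zero)
  have "\<bar>f x - f y\<bar> \<le> e"
    if "x \<in> R \<inter> {max a (c - d)<..<min b (c + d)}" "y \<in> R \<inter> {max a (c - d)<..<min b (c + d)}" for x y
  proof -
    have "\<bar>x - c\<bar> < d" "\<bar>y - c\<bar> < d" "x \<in> R" "y \<in> R" using that by auto
    then have "\<bar>f x - f c\<bar> < e / 2" "\<bar>f y - f c\<bar> < e / 2" using d(2) by blast+
    then show ?thesis by linarith
  qed
  with c d(1) show ?thesis
    by (intro exI[of _ "max a (c - d)"] exI[of _ "min b (c + d)"]) auto
qed

text \<open>A category analogue of Egorov's theorem. Pointwise convergence makes the sets
  \<open>E N\<close> cover \<open>R\<close> inside \<open>{a<..<b}\<close>, so some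
  \<open>E N\<close> is dense in an interval; continuity on \<open>R\<close> spreads its estimate to
  all points of \<open>R\<close> there.\<close>

lemma Egorov_category:
  fixes f :: "nat \<Rightarrow> real \<Rightarrow> real"
  assumes R: "residual R" and cont: "\<And>n. continuous_on R (f n)"
    and lim: "\<And>x. x \<in> R \<Longrightarrow> (\<lambda>n. f n x) \<longlonglongrightarrow> g x"
    and "e > 0" "a < b"
  shows "\<exists>l u N. a \<le> l \<and> l < u \<and> u \<le> b \<and> (\<forall>x\<in>R \<inter> {l<..<u}. \<forall>n\<ge>N. \<bar>f n x - g x\<bar> \<le> e)"
proof -
  define E where "E N = {x\<in>R. a < x \<and> x < b \<and> (\<forall>m\<ge>N. \<forall>n\<ge>N. \<bar>f m x - f n x\<bar> \<le> e)}" for N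
  have "\<exists>N. \<not> nowhere_dense (E N)"
  proof (rule ccontr)
    assume "\<nexists>N. \<not> nowhere_dense (E N)"
    then have "residual (- (\<Union>N. E N))"
      unfolding residual_def by (simp add: meager_UN nowhere_dense_imp_meager)
    with R have "residual (R \<inter> - (\<Union>N. E N))" by (rule residual_Int)
    then obtain x where x: "x \<in> R" "\<And>N. x \<notin> E N" "a < x" "x < b"
      using residual_dense[OF _ \<open>a < b\<close>] by blast
    have "Cauchy (\<lambda>n. f n x)" using lim[OF x(1)] by (rule LIMSEQ_imp_Cauchy)
    then obtain N where "\<And>m n. m \<ge> N \<Longrightarrow> n \<ge> N \<Longrightarrow> dist (f m x) (f n x) < e"
      using \<open>e > 0\<close> unfolding Cauchy_def by blast
    then have "x \<in> E N" using x by (force simp: E_def dist_real_def)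
    with x show False by blast
  qed
  then obtain N c d where "c < d"
    and meets: "\<And>l u. c \<le> l \<Longrightarrow> l < u \<Longrightarrow> u \<le> d \<Longrightarrow> {l<..<u} \<inter> E N \<noteq> {}"
    unfolding nowhere_dense_iff by blast
  define l where "l = max a c"
  define u where "u = min b d"
  \<comment> \<open>\<open>E N\<close> lies in \<open>{a<..<b}\<close> and meets
    \<open>{c<..<d}\<close>, so the two intervals overlap.\<close>
  have "l < u" using meets[of c d] \<open>c < d\<close> by (auto simp: l_def u_def E_def)
  \<comment> \<open>An excess \<open>t\<close> over the bound at \<open>x\<close> would persist at
    nearby points of \<open>R\<close>, among which are points of \<open>E N\<close>.\<close>
  have fin: "\<bar>f m x - f n x\<bar> \<le> e" if x: "x \<in> R" "l < x" "x < u" and mn: "m \<ge> N" "n \<ge> N" for x m n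
  proof (rule ccontr)
    define t where "t = \<bar>f m x - f n x\<bar> - e"
    assume "\<not> ?thesis"
    then have "t > 0" by (simp add: t_def)
    have "continuous_on R (\<lambda>y. \<bar>f m y - f n y\<bar>)"
      by (intro continuous_intros cont)
    then obtain s where s: "s > 0" "\<And>y. y \<in> R \<Longrightarrow> \<bar>y - x\<bar> < s \<Longrightarrow> \<bar>\<bar>f m y - f n y\<bar> - \<bar>f m x - f n x\<bar>\<bar> < t"
      using x(1) \<open>t > 0\<close> unfolding continuous_on_iff dist_real_def by metis
    have "{max l (x - s)<..<min u (x + s)} \<inter> E N \<noteq> {}"
      by (rule meets) (use x s in \<open>auto simp: l_def u_def\<close>)
    then obtain y where y: "l < y" "x - s < y" "y < u" "y < x + s" "y \<in> E N" by auto
    have "\<bar>\<bar>f m y - f n y\<bar> - \<bar>f m x - f n x\<bar>\<bar> < t"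
      by (rule s(2)) (use y in \<open>auto simp: E_def\<close>)
    moreover have "\<bar>f m y - f n y\<bar> \<le> e" using y mn by (auto simp: E_def)
    ultimately show False by (simp add: t_def)
  qed
  then have "\<bar>f n x - g x\<bar> \<le> e" if "x \<in> R" "l < x" "x < u" "n \<ge> N" for x n
  proof (intro tendsto_upperbound[OF _ _ trivial_limit_sequentially])
    show "(\<lambda>m. \<bar>f n x - f m x\<bar>) \<longlonglongrightarrow> \<bar>f n x - g x\<bar>"
      by (intro tendsto_intros lim that)
  qed (use that fin in \<open>auto simp: eventually_at_top_linorder\<close>)
  with \<open>l < u\<close> show ?thesis
    by (intro exI[of _ l] exI[of _ u] exI[of _ N]) (auto simp: l_def u_def)
qed

subsection \<open>Gaps of closed nowhere dense sets\<close>

text \<open>Only bounded complementary intervals count, so if the gaps of \<open>F\<close> cover its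
  complement then \<open>F\<close> is unbounded on both sides.\<close>

definition gap :: "real set \<Rightarrow> real \<Rightarrow> real \<Rightarrow> bool" where
  "gap F l u \<longleftrightarrow> l < u \<and> l \<in> F \<and> u \<in> F \<and> {l<..<u} \<inter> F = {}"

lemma gap_unique:
  assumes "gap F l u" "gap F l' u'" "{l<..<u} \<inter> {l'<..<u'} \<noteq> {}"
  shows "l = l'" "u = u'"
proof -
  obtain x where x: "l < x" "x < u" "l' < x" "x < u'" 
    using assms(3) by (simp only: disjoint_iff greaterThanLessThan_iff) blast
  have *: "l \<notin> {l'<..<u'}" "u \<notin> {l'<..<u'}" "l' \<notin> {l<..<u}" "u' \<notin> {l<..<u}"
    using assms(1,2) by (auto simp: gap_def)
  show "l = l'" "u = u'" using * x by auto
qed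

text \<open>Take the complement of a maximal disjoint family of intervals satisfying
  \<open>P\<close>. Maximality makes it nowhere dense: an interval disjoint from the family would
  contain a further admissible one.\<close>

lemma ex_nowhere_dense_with_gaps:
  assumes dense: "\<And>a b. a < b \<Longrightarrow> \<exists>l u. a \<le> l \<and> l < u \<and> u \<le> b \<and> P l u"
  shows "\<exists>F. closed F \<and> nowhere_dense F \<and> (\<forall>x. x \<notin> F \<longrightarrow> (\<exists>l u. gap F l u \<and> l < x \<and> x < u \<and> P l u))"
proof -
  define I where "I = (\<lambda>p::real \<times> real. {fst p<..<snd p})"
  define \<A> where "\<A> = {D. (\<forall>p\<in>D. fst p < snd p \<and> P (fst p) (snd p)) \<and> disjoint_family_on I D}"
  have "\<exists>M\<in>\<A>. \<forall>X\<in>\<A>. M \<subseteq> X \<longrightarrow> X = M"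
  proof (rule subset_Zorn')
    fix C assume C: "subset.chain \<A> C"
    have "I p \<inter> I q = {}" if "p \<in> X" "X \<in> C" "q \<in> Y" "Y \<in> C" "p \<noteq> q" for p q X Y
    proof -
      have "X \<subseteq> Y \<or> Y \<subseteq> X" using C that unfolding subset.chain_def by auto
      moreover have "X \<in> \<A>" "Y \<in> \<A>" using C that unfolding subset.chain_def by auto
      ultimately show ?thesis
        using that unfolding \<A>_def disjoint_family_on_def by blast
    qed
    moreover have "X \<in> \<A>" if "X \<in> C" for X using C that unfolding subset.chain_def by auto
    ultimately show "\<Union>C \<in> \<A>"
      unfolding \<A>_def disjoint_family_on_def by blast
  qed
  then obtain D where D: "D \<in> \<A>" "\<And>X. X \<in> \<A> \<Longrightarrow> D \<subseteq> X \<Longrightarrow> X = D" by blast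
  have D1: "\<And>p. p \<in> D \<Longrightarrow> fst p < snd p \<and> P (fst p) (snd p)"
    and D2: "\<And>p q. p \<in> D \<Longrightarrow> q \<in> D \<Longrightarrow> p \<noteq> q \<Longrightarrow> I p \<inter> I q = {}"
    using D(1) by (auto simp: \<A>_def disjoint_family_on_def)
  define F where "F = - (\<Union>p\<in>D. I p)"
  have "closed F" by (auto simp: F_def I_def closed_Compl)
  moreover have "nowhere_dense F"
    unfolding nowhere_dense_iff
  proof (intro allI impI)
    fix a b :: real assume "a < b"
    have "\<exists>p\<in>D. {a<..<b} \<inter> I p \<noteq> {}"
    proof (rule ccontr)
      assume no: "\<not> ?thesis"
      obtain l u where lu: "a \<le> l" "l < u" "u \<le> b" "P l u" using dense \<open>a < b\<close> by blast
      then have sub: "I (l, u) \<subseteq> {a<..<b}" by (auto simp: I_def)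
      have "I (l, u) \<noteq> {}" using lu by (auto simp: I_def)
      have ne: "(l, u) \<noteq> p" if "p \<in> D" for p
        using no sub that \<open>I (l, u) \<noteq> {}\<close> by blast
      have disj: "I (l, u) \<inter> I p = {}" if "p \<in> D" for p using no sub that by blast
      have "insert (l, u) D \<in> \<A>"
        unfolding \<A>_def disjoint_family_on_def
      proof (intro CollectI conjI ballI impI)
        fix p q assume "p \<in> insert (l, u) D" "q \<in> insert (l, u) D" "p \<noteq> q"
        then show "I p \<inter> I q = {}" using D2 disj by (metis Int_commute insertE)
      qed (use D1 lu in auto)
      then have "(l, u) \<in> D" using D(2) by blast
      with ne show False by blast
    qed
    then obtain p x where "p \<in> D" "a < x" "x < b" "x \<in> I p"
      by (meson disjoint_iff greaterThanLessThan_iff)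
    moreover from this have "{max a (fst p)<..<min b (snd p)} \<inter> F = {}"
      by (auto simp: F_def I_def)
    ultimately show "\<exists>c d. a \<le> c \<and> c < d \<and> d \<le> b \<and> {c<..<d} \<inter> F = {}"
      by (intro exI[of _ "max a (fst p)"] exI[of _ "min b (snd p)"]) (auto simp: I_def)
  qed
  moreover have "\<exists>l u. gap F l u \<and> l < x \<and> x < u \<and> P l u" if x: "x \<notin> F" for x
  proof -
    obtain p where p: "p \<in> D" "x \<in> I p" using x by (auto simp: F_def)
    have "gap F (fst p) (snd p)"
    proof -
      \<comment> \<open>An end-point lying inside another open interval of the family would make the
        two intervals overlap.\<close>
      have out: False if q: "q \<in> D" and "fst p \<in> I q \<or> snd p \<in> I q" for q
      proof -
        have "q \<noteq> p" using that by (auto simp: I_def)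
        then have e: "I p \<inter> I q = {}" using D2 p q by blast
        have "I p \<inter> I q = {max (fst p) (fst q)<..<min (snd p) (snd q)}" by (auto simp: I_def)
        moreover have "max (fst p) (fst q) < min (snd p) (snd q)"
          using that D1[OF p(1)] D1[OF q] by (auto simp: I_def)
        ultimately show False using e by auto
      qed
      have "fst p \<in> F" "snd p \<in> F" using out by (auto simp: F_def)
      then show ?thesis using D1 p unfolding gap_def by (auto simp: F_def I_def)
    qed
    then show ?thesis using p D1[OF p(1)] by (intro exI[of _ "fst p"] exI[of _ "snd p"]) (simp add: I_def)
  qed
  ultimately show ?thesis by blast
qed

text \<open>Recursion on \<open>n\<close>. The inclusions are obtained by asking each gap to avoid
  \<open>N n\<close> and the previous set: a point of these sets outside the new set would lie in
  such a gap.\<close>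

lemma ex_gap_sequence:
  assumes dense: "\<And>n a b. a < b \<Longrightarrow> \<exists>l u. a \<le> l \<and> l < u \<and> u \<le> b \<and> P n l u"
    and mono: "\<And>n l u l' u'. P n l u \<Longrightarrow> l \<le> l' \<Longrightarrow> u' \<le> u \<Longrightarrow> P n l' u'"
    and nd: "\<And>n. nowhere_dense (N n)"
  shows "\<exists>F :: nat \<Rightarrow> real set. (\<forall>n. closed (F n) \<and> nowhere_dense (F n) \<and> N n \<subseteq> F n \<and> F n \<subseteq> F (Suc n) \<and>
           (\<forall>x. x \<notin> F n \<longrightarrow> (\<exists>l u. gap (F n) l u \<and> l < x \<and> x < u \<and> P n l u)))"
proof -
  define Q where "Q n F \<longleftrightarrow> closed F \<and> nowhere_dense F \<and> N n \<subseteq> F \<and>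
      (\<forall>x. x \<notin> F \<longrightarrow> (\<exists>l u. gap F l u \<and> l < x \<and> x < u \<and> P n l u))" for n F
  have step: "\<exists>F. Q n F \<and> E \<subseteq> F" if E: "nowhere_dense E" for n E
  proof -
    have "\<exists>F. closed F \<and> nowhere_dense F \<and> (\<forall>x. x \<notin> F \<longrightarrow>
        (\<exists>l u. gap F l u \<and> l < x \<and> x < u \<and> (P n l u \<and> {l<..<u} \<inter> N n = {} \<and> {l<..<u} \<inter> E = {})))"
    proof (rule ex_nowhere_dense_with_gaps)
      fix a b :: real assume "a < b"
      then obtain a1 b1 where 1: "a \<le> a1" "a1 < b1" "b1 \<le> b" "{a1<..<b1} \<inter> N n = {}"
        using nd[of n, unfolded nowhere_dense_iff] by meson
      then obtain a2 b2 where 2: "a1 \<le> a2" "a2 < b2" "b2 \<le> b1" "{a2<..<b2} \<inter> E = {}"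
        using E[unfolded nowhere_dense_iff] by meson
      then obtain l u where 3: "a2 \<le> l" "l < u" "u \<le> b2" "P n l u" using dense by meson
      have sub: "{l<..<u} \<subseteq> {a1<..<b1}" "{l<..<u} \<subseteq> {a2<..<b2}" using 2 3 by auto
      show "\<exists>l u. a \<le> l \<and> l < u \<and> u \<le> b \<and> P n l u \<and> {l<..<u} \<inter> N n = {} \<and> {l<..<u} \<inter> E = {}"
        by (rule exI[of _ l], rule exI[of _ u]) (use 1 2 3 sub in auto)
    qed
    then obtain F where F: "closed F" "nowhere_dense F"
      "\<And>x. x \<notin> F \<Longrightarrow> \<exists>l u. gap F l u \<and> l < x \<and> x < u \<and> P n l u \<and> {l<..<u} \<inter> N n = {} \<and> {l<..<u} \<inter> E = {}"
      by blast
    have "x \<in> F" if "x \<in> N n \<union> E" for x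
    proof (rule ccontr)
      assume "x \<notin> F"
      with F(3) that show False by fastforce
    qed
    with F show ?thesis unfolding Q_def by (intro exI[of _ F]) blast
  qed
  have "\<exists>F. \<forall>n. Q n (F n) \<and> F n \<subseteq> F (Suc n)"
  proof (rule dependent_nat_choice)
    show "\<exists>F. Q 0 F" using step[of "{}" 0] by (auto simp: nowhere_dense_def)
  next
    fix E n assume "Q n E"
    then show "\<exists>F. Q (Suc n) F \<and> E \<subseteq> F" using step[of E "Suc n"] by (auto simp: Q_def)
  qed
  then show ?thesis unfolding Q_def by blast
qed

section \<open>Gluing functions over the gaps of a set\<close>

definition gap_left :: "real set \<Rightarrow> real \<Rightarrow> real" where
  "gap_left F x = (THE l. \<exists>u. gap F l u \<and> l < x \<and> x < u)"

definition gap_right :: "real set \<Rightarrow> real \<Rightarrow> real" where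
  "gap_right F x = (THE u. \<exists>l. gap F l u \<and> l < x \<and> x < u)"

text \<open>\<open>h\<close> receives the end-points so that each gap can carry its own function.
  \<open>gap_left\<close> and \<open>gap_right\<close> are unspecified at points in no gap;
  \<open>glue\<close> is meant for sets whose gaps cover the complement.\<close>

definition glue :: "real set \<Rightarrow> (real \<Rightarrow> real) \<Rightarrow> (real \<Rightarrow> real \<Rightarrow> real \<Rightarrow> real) \<Rightarrow> real \<Rightarrow> real" where
  "glue F f h x = (if x \<in> F then f x else h (gap_left F x) (gap_right F x) x)"

lemma gap_left_right_eq:
  assumes "gap F l u" "l < x" "x < u"
  shows "gap_left F x = l" "gap_right F x = u"
proof -
  have "l' = l \<and> u' = u" if "gap F l' u'" "l' < x" "x < u'" for l' u'
    using gap_unique[OF that(1) assms(1)] that assms by auto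
  with assms show "gap_left F x = l" "gap_right F x = u"
    unfolding gap_left_def gap_right_def by (blast intro: the_equality)+
qed

lemma glue_on_set: "x \<in> F \<Longrightarrow> glue F f h x = f x"
  by (simp add: glue_def)

lemma glue_on_gap: "gap F l u \<Longrightarrow> x \<in> {l<..<u} \<Longrightarrow> glue F f h x = h l u x"
  by (auto simp: glue_def gap_left_right_eq) (auto simp: gap_def)

lemma continuous_on_glue_gap:
  assumes "gap F l u" "continuous_on {l<..<u} (h l u)"
  shows "continuous_on {l<..<u} (glue F f h)"
  using assms(2) by (rule continuous_on_eq) (simp add: glue_on_gap[OF assms(1)])

section \<open>Continuous functions taking prescribed values near both ends of an interval\<close>

lemma exists_mult_sin_eq:
  fixes M y :: real
  shows "\<exists>t\<ge>M. t * sin t = y"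
proof -
  obtain k :: nat where k: "real k \<ge> max \<bar>M\<bar> \<bar>y\<bar>" using real_arch_simple by blast
  \<comment> \<open>The sine is 1 at \<open>t1\<close> and -1 at \<open>t2\<close>, and both points
    lie beyond the absolute values of \<open>M\<close> and \<open>y\<close>, so \<open>y\<close>
    lies between the two values of \<open>t * sin t\<close>.\<close>
  define t1 t2 where "t1 = pi / 2 + 2 * pi * real k" and "t2 = 3 * pi / 2 + 2 * pi * real k"
  have "real k \<le> 2 * pi * real k"
    using mult_right_mono[of 1 "2 * pi" "real k"] pi_gt3 by simp
  then have t: "max \<bar>M\<bar> \<bar>y\<bar> \<le> t1" "t1 \<le> t2" using k pi_gt3 by (auto simp: t1_def t2_def)
  have s1: "sin t1 = 1"
    using sin_periodic_pi sin_2npi[of k] cos_2npi[of k]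
    by (simp add: t1_def sin_add mult.commute mult.left_commute)
  have s2: "sin t2 = -1"
  proof -
    have "t2 = t1 + pi" by (simp add: t1_def t2_def)
    then show ?thesis using s1 by (simp add: sin_add)
  qed
  have "\<exists>t\<ge>t1. t \<le> t2 \<and> t * sin t = y"
  proof (rule IVT2')
    show "t2 * sin t2 \<le> y" "y \<le> t1 * sin t1" using t s1 s2 by auto
  qed (use t in \<open>auto intro!: continuous_intros\<close>)
  with t show ?thesis by (metis abs_ge_self dual_order.trans max.bounded_iff)
qed

text \<open>If \<open>s\<close> tends to infinity at both ends, then \<open>s x * sin (s x)\<close>
  runs through all reals near each end. The right end is the left end of the reflected interval,
  which is why \<open>s\<close> keeps \<open>l\<close> and \<open>u\<close> as parameters.\<close>

lemma oscillating_function_UNIV: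
  fixes l u :: real
  assumes "l < u"
  shows "\<exists>h. continuous_on {l<..<u} h \<and> (\<forall>c\<in>{l<..<u}. h ` {l<..<c} = UNIV \<and> h ` {c<..<u} = (UNIV :: real set))"
proof -
  define s where "s l u x = 1 / (x - l) + 1 / (u - x)" for l u x :: real
  have cont: "continuous_on {l<..<u} (s l u)" for l u
    unfolding s_def by (intro continuous_intros) auto
  have surj: "\<exists>x. l < x \<and> x < c \<and> s l u x = t"
    if lc: "l < c" "c < u" and t: "s l u ((l + c) / 2) \<le> t" for l u c t
  proof -
    define m where "m = (l + c) / 2"
    have m: "l < m" "m < c" "m < u" using lc by (auto simp: m_def)
    have "s l u m > 0" using m by (auto simp: s_def intro: add_pos_pos)
    then have "t > 0" using t by (simp add: m_def)
    \<comment> \<open>So close to \<open>l\<close> that \<open>1 / (x0 - l)\<close> is at least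
      \<open>t\<close>; the intermediate value theorem on \<open>{x0..m}\<close> then yields
      \<open>t\<close>.\<close>
    define x0 where "x0 = min m (l + 1 / t)"
    have x0: "l < x0" "x0 \<le> m" "x0 - l \<le> 1 / t" using m \<open>t > 0\<close> by (auto simp: x0_def)
    have "t \<le> 1 / (x0 - l)" using x0 \<open>t > 0\<close> by (simp add: field_simps)
    also have "\<dots> \<le> s l u x0" using x0 m by (auto simp: s_def)
    finally have "t \<le> s l u x0" .
    have "\<exists>x\<ge>x0. x \<le> m \<and> s l u x = t"
    proof (rule IVT2')
      show "continuous_on {x0..m} (s l u)"
        using cont by (rule continuous_on_subset) (use x0 m in auto)
    qed (use t x0 \<open>t \<le> s l u x0\<close> in \<open>auto simp: m_def\<close>)
    with x0 m show ?thesis by (metis order.strict_trans1 order.strict_trans2)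
  qed
  have left: "\<exists>x. l < x \<and> x < c \<and> s l u x * sin (s l u x) = y" if "l < c" "c < u" for l u c y
    using exists_mult_sin_eq surj[OF that] by metis
  define h where "h x = s l u x * sin (s l u x)" for x
  have "continuous_on {l<..<u} h"
    unfolding h_def by (intro continuous_intros cont)
  moreover have "y \<in> h ` {l<..<c}" if "c \<in> {l<..<u}" for c y
    using left[of l c u y] that by (auto simp: h_def)
  moreover have "y \<in> h ` {c<..<u}" if c: "c \<in> {l<..<u}" for c y
  proof -
    obtain x where x: "- u < x" "x < - c" "s (- u) (- l) x * sin (s (- u) (- l) x) = y"
      using left[of "- u" "- c" "- l" y] c by auto
    have "s (- u) (- l) x = s l u (- x)" by (simp add: s_def add.commute)
    with x show ?thesis by (intro image_eqI[of _ _ "- x"]) (auto simp: h_def)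
  qed
  ultimately show ?thesis by (intro exI[of _ h]) blast
qed

lemma oscillating_function:
  fixes l u :: real
  assumes "l < u" "K = UNIV \<or> (\<exists>v r. r > 0 \<and> K = {v - r<..<v + r})"
  shows "\<exists>h. continuous_on {l<..<u} h \<and> (\<forall>c\<in>{l<..<u}. h ` {l<..<c} = K \<and> h ` {c<..<u} = (K :: real set))"
  using assms(2)
proof
  assume "K = UNIV"
  then show ?thesis using oscillating_function_UNIV[OF assms(1)] by simp
next
  assume "\<exists>v r. r > 0 \<and> K = {v - r<..<v + r}"
  then obtain v r where vr: "r > 0" "K = {v - r<..<v + r}" by blast
  obtain h where h: "continuous_on {l<..<u} h"
    "\<forall>c\<in>{l<..<u}. h ` {l<..<c} = UNIV \<and> h ` {c<..<u} = (UNIV :: real set)"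
    using oscillating_function_UNIV[OF assms(1)] by blast
  \<comment> \<open>A rescaled arctangent maps the line onto \<open>{v - r<..<v + r}\<close>, so
    composing with it confines the oscillation and omits no value of \<open>K\<close>.\<close>
  define q where "q y = v + r * (2 / pi * arctan y)" for y
  have "q ` UNIV = K"
  proof (intro equalityI subsetI)
    fix z assume "z \<in> q ` UNIV"
    then obtain y where y: "z = q y" by blast
    have "\<bar>2 / pi * arctan y\<bar> < 1"
      using arctan_bounded[of y] pi_gt_zero by (auto simp: abs_less_iff field_simps)
    then have "\<bar>r * (2 / pi * arctan y)\<bar> < r"
      using vr(1) mult_strict_left_mono[of "\<bar>2 / pi * arctan y\<bar>" 1 r] by (simp add: abs_mult)
    moreover have "v - r < v + w \<and> v + w < v + r" if "\<bar>w\<bar> < r" for w using that by linarith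
    ultimately show "z \<in> K" unfolding y vr(2) q_def greaterThanLessThan_iff by blast
  next
    fix z assume "z \<in> K"
    then have z: "- 1 < (z - v) / r" "(z - v) / r < 1" using vr by (auto simp: field_simps)
    then have "- (pi / 2) < (z - v) / r * (pi / 2)" "(z - v) / r * (pi / 2) < pi / 2"
      using mult_strict_right_mono[of "-1" "(z - v) / r" "pi / 2"]
        mult_strict_right_mono[of "(z - v) / r" 1 "pi / 2"] by auto
    then have "arctan (tan ((z - v) / r * (pi / 2))) = (z - v) / r * (pi / 2)"
      by (intro arctan_tan) auto
    then have "q (tan ((z - v) / r * (pi / 2))) = z" using vr(1)
      by (simp add: q_def) (simp add: field_simps)
    then show "z \<in> q ` UNIV" by (metis rangeI)
  qed
  then have "(q \<circ> h) ` {l<..<c} = K \<and> (q \<circ> h) ` {c<..<u} = K" if "c \<in> {l<..<u}" for c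
    using h(2) that by (metis image_comp)
  moreover have "continuous_on {l<..<u} (q \<circ> h)"
    unfolding q_def comp_def by (intro continuous_intros h)
  ultimately show ?thesis by (intro exI[of _ "q \<circ> h"]) blast
qed

text \<open>If \<open>{a..b}\<close> misses \<open>F\<close>, the glued function is continuous there
  and the intermediate value theorem applies. Otherwise the gap supplied by \<open>key\<close> does
  not contain \<open>p\<close>, so it has an end-point in \<open>{a..b}\<close>, near which
  \<open>h\<close> takes every value of \<open>K l u\<close> at continuity points.\<close>

lemma swiatkowski_glue:
  assumes F: "nowhere_dense F" "\<And>x. x \<notin> F \<Longrightarrow> \<exists>l u. gap F l u \<and> l < x \<and> x < u"
    and h: "\<And>l u. gap F l u \<Longrightarrow> continuous_on {l<..<u} (h l u)"
      "\<And>l u c. gap F l u \<Longrightarrow> c \<in> {l<..<u} \<Longrightarrow> h l u ` {l<..<c} = K l u \<and> h l u ` {c<..<u} = K l u"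
    and key: "\<And>a b p. a < b \<Longrightarrow> a \<le> p \<Longrightarrow> p \<le> b \<Longrightarrow> p \<in> F \<Longrightarrow> glue F f h a \<noteq> glue F f h b \<Longrightarrow>
      \<exists>l u. gap F l u \<and> {l<..<u} \<inter> {a<..<b} \<noteq> {} \<and>
        (\<exists>y\<in>K l u. min (glue F f h a) (glue F f h b) < y \<and> y < max (glue F f h a) (glue F f h b))"
  shows "swiatkowski (glue F f h)"
  unfolding swiatkowski_def
proof (intro allI impI, elim conjE)
  fix a b :: real
  define g where "g = glue F f h"
  assume "a < b" and ne: "glue F f h a \<noteq> glue F f h b"
  have isC: "isCont g x" if "gap F l u" "x \<in> {l<..<u}" for l u x
    using continuous_on_glue_gap[where f = f and h = h and l = l and u = u] h(1) that
    by (simp add: continuous_on_eq_continuous_at g_def)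
  have "\<exists>x\<in>{a<..<b}. isCont g x \<and> min (g a) (g b) < g x \<and> g x < max (g a) (g b)"
  proof (cases "{a..b} \<inter> F = {}")
    case True
    have C: "isCont g x" if "a \<le> x" "x \<le> b" for x
    proof -
      have "x \<notin> F" using that True by auto
      then obtain l u where "gap F l u" "l < x" "x < u" using F(2) by blast
      then show ?thesis using isC by simp
    qed
    define y where "y = (g a + g b) / 2"
    have y: "min (g a) (g b) < y" "y < max (g a) (g b)" using ne by (auto simp: y_def g_def)
    have "\<exists>x\<ge>a. x \<le> b \<and> g x = y"
    proof (cases "g a \<le> g b")
      case True
      then show ?thesis using IVT[of g a y b] C \<open>a < b\<close> y by simp
    next
      case False
      then show ?thesis using IVT2[of g b y a] C \<open>a < b\<close> y by simp
    qed
    then obtain x where x: "a \<le> x" "x \<le> b" "g x = y" by blast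
    then have "x \<noteq> a" "x \<noteq> b" using y by auto
    with x y C show ?thesis by (intro bexI[of _ x]) auto
  next
    case False
    then obtain p where p: "p \<in> F" "a \<le> p" "p \<le> b" by auto
    obtain l u y where lu: "gap F l u" "{l<..<u} \<inter> {a<..<b} \<noteq> {}"
      and y: "y \<in> K l u" "min (g a) (g b) < y" "y < max (g a) (g b)"
      using key[OF \<open>a < b\<close> p(2,3,1) ne] unfolding g_def by blast
    obtain z where z: "l < z" "z < u" "a < z" "z < b"
      using lu(2) by (simp only: disjoint_iff greaterThanLessThan_iff) blast
    have "p \<notin> {l<..<u}" using p(1) lu(1) by (auto simp: gap_def)
    \<comment> \<open>The part of the gap between \<open>z\<close> and the end facing
      \<open>p\<close> lies inside \<open>{a<..<b}\<close>.\<close>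
    then consider "p \<le> l" | "u \<le> p" by force
    then have "\<exists>x\<in>{l<..<u}. x \<in> {a<..<b} \<and> h l u x = y"
    proof cases
      case 1
      have "y \<in> h l u ` {l<..<z}" using h(2)[OF lu(1), of z] y(1) z by auto
      then obtain x where "x \<in> {l<..<z}" "h l u x = y" by auto
      with 1 p z show ?thesis by (intro bexI[of _ x]) auto
    next
      case 2
      have "y \<in> h l u ` {z<..<u}" using h(2)[OF lu(1), of z] y(1) z by auto
      then obtain x where "x \<in> {z<..<u}" "h l u x = y" by auto
      with 2 p z show ?thesis by (intro bexI[of _ x]) auto
    qed
    then obtain x where x: "x \<in> {l<..<u}" "x \<in> {a<..<b}" "h l u x = y" by blast
    moreover have "g x = y" using glue_on_gap[OF lu(1) x(1)] x(3) by (simp add: g_def)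
    ultimately show ?thesis using y isC[OF lu(1) x(1)] by (intro bexI[of _ x]) auto
  qed
  then show "\<exists>x\<in>{a<..<b}. isCont (glue F f h) x \<and> min (glue F f h a) (glue F f h b) < glue F f h x \<and>
      glue F f h x < max (glue F f h a) (glue F f h b)"
    by (simp add: g_def)
qed

subsection \<open>Limits of functions with the Baire property\<close>

text \<open>Used for a property \<open>P k\<close> at every precision \<open>k\<close> and followed
  by \<open>residual_INT\<close>, this turns densely many good intervals into one residual set of
  points.\<close>

lemma residual_interval_cover:
  assumes "\<And>a b. a < b \<Longrightarrow> \<exists>l u. a \<le> l \<and> l < u \<and> u \<le> b \<and> P l u"
  shows "residual {x. \<exists>l u. l < x \<and> x < u \<and> P l u}" (is "residual ?G")
proof (rule residual_open)
  show "open ?G"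
  proof -
    have "?G = (\<Union>p\<in>{p. P (fst p) (snd p)}. {fst p<..<snd p})" by force
    then show ?thesis by auto
  qed
next
  fix a b :: real assume "a < b"
  then obtain l u where lu: "a \<le> l" "l < u" "u \<le> b" "P l u" using assms[OF \<open>a < b\<close>] by auto
  moreover from dense[OF lu(2)] obtain x where "l < x" "x < u" by blast
  ultimately have "a < x" "x < b" "x \<in> ?G" by auto
  then show "\<exists>x\<in>?G. a < x \<and> x < b" by auto
qed

text \<open>Every interval has a subinterval of small oscillation: either \<open>f\<close> is
  constant there, or the Swiatkowski condition supplies a continuity point.\<close>

lemma swiatkowski_imp_Baire:
  assumes "swiatkowski f"
  shows "has_Baire_property f"
proof -
  define P where "P k l u \<longleftrightarrow> (\<forall>y\<in>{l<..<u}. \<forall>z\<in>{l<..<u}. \<bar>f y - f z\<bar> \<le> inverse (real (Suc k)))" for k l u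
  define R where "R = (\<Inter>k. {x. \<exists>l u. l < x \<and> x < u \<and> P k l u})"
  have "residual R"
    unfolding R_def
  proof (rule residual_INT, rule residual_interval_cover)
    fix k and a b :: real assume "a < b"
    show "\<exists>l u. a \<le> l \<and> l < u \<and> u \<le> b \<and> P k l u"
    proof (cases "\<forall>y\<in>{a<..<b}. \<forall>z\<in>{a<..<b}. f y = f z")
      case True
      have "P k a b"
        unfolding P_def
      proof (intro ballI)
        fix y z assume "y \<in> {a<..<b}" "z \<in> {a<..<b}"
        then have "f y = f z" using True by blast
        then show "\<bar>f y - f z\<bar> \<le> inverse (real (Suc k))" by simp
      qed
      with \<open>a < b\<close> show ?thesis by blast
    next
      case False
      then obtain y z where yz: "y \<in> {a<..<b}" "z \<in> {a<..<b}" "f y \<noteq> f z" by blast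
      have "min y z < max y z" "f (min y z) \<noteq> f (max y z)"
        using yz(3) by (cases y z rule: linorder_cases; simp)+
      then obtain x where "x \<in> {min y z<..<max y z}" "isCont f x"
        using assms[unfolded swiatkowski_def, rule_format, of "min y z" "max y z"] by blast
      then have x: "a < x" "x < b" "isCont f x" using yz(1,2) by auto
      from x(3) obtain d where d: "d > 0" "\<forall>x'. dist x' x < d \<longrightarrow> dist (f x') (f x) < inverse (real (Suc k)) / 2"
        unfolding continuous_at_eps_delta by (elim allE[of _ "inverse (real (Suc k)) / 2"]) auto
      have "P k (max a (x - d)) (min b (x + d))"
        unfolding P_def
      proof (intro ballI)
        fix y z assume "y \<in> {max a (x - d)<..<min b (x + d)}" "z \<in> {max a (x - d)<..<min b (x + d)}"
        then have "dist y x < d" "dist z x < d" by (auto simp: dist_real_def)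
        then have "dist (f y) (f x) < inverse (real (Suc k)) / 2" "dist (f z) (f x) < inverse (real (Suc k)) / 2"
          using d by blast+
        then show "\<bar>f y - f z\<bar> \<le> inverse (real (Suc k))" unfolding dist_real_def by linarith
      qed
      with x d(1) show ?thesis
        by (intro exI[of _ "max a (x - d)"] exI[of _ "min b (x + d)"]) auto
    qed
  qed
  moreover have "continuous_on R f"
    unfolding continuous_on_iff
  proof (intro ballI allI impI)
    fix x e :: real assume "x \<in> R" "e > 0"
    obtain k where k: "inverse (real (Suc k)) < e" using reals_Archimedean[OF \<open>e > 0\<close>] by blast
    obtain l u where lu: "l < x" "x < u" "P k l u" using \<open>x \<in> R\<close> unfolding R_def by blast
    show "\<exists>d>0. \<forall>x'\<in>R. dist x' x < d \<longrightarrow> dist (f x') (f x) < e"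
    proof (intro exI[of _ "min (x - l) (u - x)"] conjI ballI impI)
      fix x' assume "dist x' x < min (x - l) (u - x)"
      then have "x' \<in> {l<..<u}" "x \<in> {l<..<u}" using lu by (auto simp: dist_real_def)
      then have "\<bar>f x' - f x\<bar> \<le> inverse (real (Suc k))" using lu(3) unfolding P_def by blast
      with k show "dist (f x') (f x) < e" by (simp add: dist_real_def)
    qed (use lu in auto)
  qed
  ultimately show ?thesis unfolding has_Baire_property_iff by blast
qed

lemma residual_continuity_sets:
  assumes "\<And>n::nat. has_Baire_property (f n)"
  shows "\<exists>R. residual R \<and> (\<forall>n. continuous_on R (f n))"
proof -
  have "\<forall>n. \<exists>R. residual R \<and> continuous_on R (f n)"
    using assms by (simp add: has_Baire_property_iff)
  then obtain Q where Q: "\<forall>n. residual (Q n) \<and> continuous_on (Q n) (f n)"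
    unfolding choice_iff by blast
  then have "residual (\<Inter>n. Q n)" by (intro residual_INT) blast
  moreover have "continuous_on (\<Inter>n. Q n) (f n)" for n
    by (rule continuous_on_subset[of "Q n"]) (use Q in auto)
  ultimately show ?thesis by blast
qed

text \<open>Around each point of \<open>T\<close> and for every \<open>k\<close>, some
  \<open>f N\<close> is within \<open>1/(k+1)\<close> of \<open>g\<close> on \<open>R\<close>;
  splitting the error into thirds transfers continuity to \<open>g\<close>.\<close>

lemma has_Baire_property_limit:
  assumes bp: "\<And>n::nat. has_Baire_property (f n)" and lim: "\<And>x. (\<lambda>n. f n x) \<longlonglongrightarrow> g x"
  shows "has_Baire_property g"
proof -
  obtain R where R: "residual R" "\<And>n. continuous_on R (f n)"
    using residual_continuity_sets[of f, OF bp] by meson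
  define P where "P k l u \<longleftrightarrow> (\<exists>N. \<forall>x\<in>R \<inter> {l<..<u}. \<forall>n\<ge>N. \<bar>f n x - g x\<bar> \<le> inverse (real (Suc k)))" for k l u
  define T where "T = R \<inter> (\<Inter>k. {x. \<exists>l u. l < x \<and> x < u \<and> P k l u})"
  have "residual T"
    unfolding T_def
  proof (intro residual_Int R(1) residual_INT residual_interval_cover)
    fix k and a b :: real assume "a < b"
    then show "\<exists>l u. a \<le> l \<and> l < u \<and> u \<le> b \<and> P k l u"
      unfolding P_def using Egorov_category[OF R(1) R(2) lim, of "inverse (real (Suc k))" a b] by simp
  qed
  moreover have "continuous_on T g"
    unfolding continuous_on_iff
  proof (intro ballI allI impI)
    fix x e :: real assume "x \<in> T" "e > 0"
    obtain k where k: "inverse (real (Suc k)) < e / 3" using reals_Archimedean[of "e / 3"] \<open>e > 0\<close> by auto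
    obtain l u where lu: "l < x" "x < u" "P k l u" using \<open>x \<in> T\<close> unfolding T_def by blast
    then obtain N where N: "\<forall>x\<in>R \<inter> {l<..<u}. \<forall>n\<ge>N. \<bar>f n x - g x\<bar> \<le> inverse (real (Suc k))"
      unfolding P_def by blast
    have "x \<in> R" using \<open>x \<in> T\<close> by (simp add: T_def)
    then obtain d where d: "d > 0" "\<forall>x'\<in>R. dist x' x < d \<longrightarrow> dist (f N x') (f N x) < e / 3"
      using R(2)[of N, unfolded continuous_on_iff, rule_format, of x "e / 3"] \<open>e > 0\<close> by auto
    show "\<exists>d>0. \<forall>x'\<in>T. dist x' x < d \<longrightarrow> dist (g x') (g x) < e"
    proof (intro exI[of _ "min d (min (x - l) (u - x))"] conjI ballI impI)
      fix x' assume x': "x' \<in> T" "dist x' x < min d (min (x - l) (u - x))"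
      then have "x' \<in> R \<inter> {l<..<u}" "x \<in> R \<inter> {l<..<u}"
        using lu \<open>x \<in> R\<close> by (auto simp: dist_real_def T_def)
      then have "\<bar>f N x' - g x'\<bar> \<le> inverse (real (Suc k))" "\<bar>f N x - g x\<bar> \<le> inverse (real (Suc k))"
        using N by blast+
      moreover have "\<bar>f N x' - f N x\<bar> < e / 3"
        using d x' by (simp add: dist_real_def T_def)
      ultimately show "dist (g x') (g x) < e" using k unfolding dist_real_def by linarith
    qed (use lu d in auto)
  qed
  ultimately show ?thesis unfolding has_Baire_property_iff by blast
qed

section \<open>The condition S on intervals\<close>

lemma S_J_mono: "S_J J A e f \<Longrightarrow> J' \<subseteq> J \<Longrightarrow> S_J J' A e f"
  unfolding S_J_def by blast

text \<open>\<open>S_J\<close> passes to subintervals, so a good interval meeting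
  \<open>{a<..<b}\<close> can be trimmed to fit into it.\<close>

lemma S_prop_iff:
  "S_prop A e f \<longleftrightarrow> (\<forall>a b. a < b \<longrightarrow> (\<exists>l u. a \<le> l \<and> l < u \<and> u \<le> b \<and> S_J {l<..<u} A e f))"
    (is "_ \<longleftrightarrow> ?R")
proof
  assume S: "S_prop A e f"
  show ?R
  proof (intro allI impI)
    fix a b :: real assume "a < b"
    then have "(a + b) / 2 \<in> {a<..<b}" by simp
    moreover have "(a + b) / 2 \<in> closure (\<Union>{J. is_open_interval J \<and> S_J J A e f})"
      using S by (simp add: S_prop_def)
    ultimately have "{a<..<b} \<inter> \<Union>{J. is_open_interval J \<and> S_J J A e f} \<noteq> {}"
      using open_Int_closure_eq_empty[OF open_greaterThanLessThan, of a b] by blast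
    then obtain J y where J: "is_open_interval J" "S_J J A e f" "y \<in> {a<..<b} \<inter> J" by blast
    then have "open ({a<..<b} \<inter> J)" by (auto simp: is_open_interval_def)
    then obtain d where d: "d > 0" "ball y d \<subseteq> {a<..<b} \<inter> J" using J(3) openE by blast
    have "{max a (y - d)<..<min b (y + d)} \<subseteq> ball y d" by (auto simp: dist_real_def)
    with d have "S_J {max a (y - d)<..<min b (y + d)} A e f" using S_J_mono[OF J(2)] by blast
    with d J(3) show "\<exists>l u. a \<le> l \<and> l < u \<and> u \<le> b \<and> S_J {l<..<u} A e f"
      by (intro exI[of _ "max a (y - d)"] exI[of _ "min b (y + d)"]) auto
  qed
next
  assume R: ?R
  have "x \<in> closure (\<Union>{J. is_open_interval J \<and> S_J J A e f})" for x
    unfolding closure_approachable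
  proof (intro allI impI)
    fix d :: real assume "d > 0"
    then obtain l u where lu: "x - d \<le> l" "l < u" "u \<le> x + d" "S_J {l<..<u} A e f"
      using R[rule_format, of "x - d" "x + d"] by auto
    from dense[OF lu(2)] obtain y where y: "l < y" "y < u" by blast
    have "is_open_interval {l<..<u}" using lu by (auto simp: is_open_interval_def)
    with lu y show "\<exists>y\<in>\<Union>{J. is_open_interval J \<and> S_J J A e f}. dist y x < d"
      by (intro bexI[of _ y] UnionI[of "{l<..<u}"]) (auto simp: dist_real_def)
  qed
  then show "S_prop A e f" unfolding S_prop_def by blast
qed

text \<open>Some \<open>f n\<close> takes a value strictly between \<open>f n x\<close> and
  \<open>f n y\<close> at a continuity point \<open>z\<close>. A nearby point \<open>w\<close> of
  \<open>R\<close> still gives a value in between, and on \<open>R\<close> inside the interval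
  \<open>f n\<close> is uniformly close to \<open>g\<close>.\<close>

lemma LIMf_Swiat_subset: "LIMf Swiat_class \<subseteq> frakS"
proof
  fix g assume "g \<in> LIMf Swiat_class"
  then obtain f where f: "\<And>n. swiatkowski (f n)" and lim: "\<And>x. (\<lambda>n. f n x) \<longlonglongrightarrow> g x"
    unfolding LIMf_def Swiat_class_def by blast
  note bp = swiatkowski_imp_Baire[OF f]
  have "S_prop A e g" if A: "residual A" "e > 0" for A e
    unfolding S_prop_iff
  proof (intro allI impI)
    fix a b :: real assume "a < b"
    obtain R0 where R0: "residual R0" "\<And>n. continuous_on R0 (f n)"
      using residual_continuity_sets[of f, OF bp] by meson
    \<comment> \<open>Intersecting with \<open>A\<close> makes the final witness \<open>w\<close> a
      point of \<open>A\<close>.\<close>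
    define R where "R = A \<inter> R0"
    have R: "residual R" "\<And>n. continuous_on R (f n)"
      using R0 A residual_Int continuous_on_subset unfolding R_def by blast+
    obtain l u N where lu: "a \<le> l" "l < u" "u \<le> b"
      and N: "\<forall>x\<in>R \<inter> {l<..<u}. \<forall>n\<ge>N. \<bar>f n x - g x\<bar> \<le> e / 4"
      using Egorov_category[OF R(1) R(2) lim, of "e / 4" a b] A(2) \<open>a < b\<close> by auto
    have "S_J {l<..<u} A e g"
      unfolding S_J_def
    proof (intro ballI impI)
      \<comment> \<open>\<open>x\<close> and \<open>y\<close> may lie outside \<open>R\<close>, so
        \<open>n\<close> is chosen depending on them, whereas \<open>N\<close> serves all points of
        \<open>R\<close> in \<open>{l<..<u}\<close> at once.\<close>
      fix x y assume x: "x \<in> {l<..<u}" and y: "y \<in> {l<..<u}" and "g x < g y"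
      have "\<forall>\<^sub>F n in sequentially. \<bar>f n x - g x\<bar> < e / 4" "\<forall>\<^sub>F n in sequentially. \<bar>f n y - g y\<bar> < e / 4"
        using tendstoD[OF lim, of "e / 4"] A(2) by (simp_all add: dist_real_def)
      moreover have "\<forall>\<^sub>F n in sequentially. 0 < f n y - f n x"
        using \<open>g x < g y\<close> by (intro order_tendstoD(1)[OF tendsto_diff[OF lim lim]]) simp
      ultimately have "\<forall>\<^sub>F n in sequentially. \<bar>f n x - g x\<bar> < e / 4 \<and> \<bar>f n y - g y\<bar> < e / 4 \<and> 0 < f n y - f n x \<and> N \<le> n"
        using eventually_ge_at_top[of N] by eventually_elim blast
      then obtain n where n: "\<bar>f n x - g x\<bar> < e / 4" "\<bar>f n y - g y\<bar> < e / 4" "f n x < f n y" "N \<le> n"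
        using eventually_happens'[OF sequentially_bot] by fastforce
      have "min x y < max x y" "f n (min x y) \<noteq> f n (max x y)"
        using n(3) by (cases x y rule: linorder_cases; simp)+
      then obtain z where "z \<in> {min x y<..<max x y}" "isCont (f n) z"
        "min (f n (min x y)) (f n (max x y)) < f n z" "f n z < max (f n (min x y)) (f n (max x y))"
        using f[of n, unfolded swiatkowski_def, rule_format, of "min x y" "max x y"] by blast
      then have z: "min x y < z" "z < max x y" "isCont (f n) z" "f n x < f n z" "f n z < f n y"
        using n(3) by (auto simp: min_def max_def split: if_splits)
      obtain d where d: "d > 0" "\<forall>w. dist w z < d \<longrightarrow> dist (f n w) (f n z) < min (f n z - f n x) (f n y - f n z)"
        using z(3-5) unfolding continuous_at_eps_delta by (metis diff_gt_0_iff_gt min_less_iff_conj)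
      have "max (z - d) (min x y) < min (z + d) (max x y)" using d z by auto
      then obtain w where w: "w \<in> R" "max (z - d) (min x y) < w" "w < min (z + d) (max x y)"
        using residual_dense[OF R(1), of "max (z - d) (min x y)" "min (z + d) (max x y)"] by blast
      then have "dist w z < d" by (auto simp: dist_real_def)
      then have "\<bar>f n w - f n z\<bar> < min (f n z - f n x) (f n y - f n z)"
        using d(2) by (simp add: dist_real_def)
      moreover have "w \<in> R \<inter> {l<..<u}" using w x y by auto
      then have "\<bar>f n w - g w\<bar> \<le> e / 4" using N n(4) by blast
      ultimately have "g x - e < g w \<and> g w < g y + e" using n A(2) by linarith
      then show "\<exists>x'\<in>A \<inter> open_interval x y. g x - e < g x' \<and> g x' < g y + e"
        using w by (intro bexI[of _ w]) (auto simp: open_interval_def R_def)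
    qed
    with lu show "\<exists>l u. a \<le> l \<and> l < u \<and> u \<le> b \<and> S_J {l<..<u} A e g" by blast
  qed
  then show "g \<in> frakS"
    using has_Baire_property_limit[of f, OF bp lim] unfolding frakS_def by blast
qed

subsection \<open>Approximation by Swiatkowski functions\<close>

text \<open>An open interval containing \<open>x\<close> also contains points slightly displaced
  from \<open>x\<close> towards \<open>y\<close>, however far away \<open>y\<close> is.\<close>

lemma interval_values_meet:
  fixes x y r v :: real
  assumes "\<bar>x - v\<bar> < r" "x \<noteq> y"
  shows "\<exists>z\<in>{v - r<..<v + r}. min x y < z \<and> z < max x y"
proof (cases "x < y")
  case True
  then have "x < min y (v + r)" using assms(1) by auto
  from dense[OF this] obtain z where "x < z" "z < min y (v + r)" by blast
  with True assms(1) show ?thesis by (intro bexI[of _ z]) auto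
next
  case False
  then have "max y (v - r) < x" using assms by auto
  from dense[OF this] obtain z where "max y (v - r) < z" "z < x" by blast
  with False assms(1) show ?thesis by (intro bexI[of _ z]) auto
qed

text \<open>Two demands compete: on each gap the approximant must sweep enough values for the
  Swiatkowski condition across points of \<open>F n\<close>, yet its distance from \<open>f\<close>
  must vanish in the limit. The level of a gap reconciles them.\<close>

lemma frakS_subset_LIMf: "frakS \<subseteq> LIMf Swiat_class"
proof
  fix f assume "f \<in> frakS"
  then have bp: "has_Baire_property f" and S: "\<And>A e. residual A \<Longrightarrow> e > 0 \<Longrightarrow> S_prop A e f"
    unfolding frakS_def by blast+
  from bp obtain R where R: "residual R" "continuous_on R f" unfolding has_Baire_property_iff by blast
  from residual_cover[OF R(1)] obtain N :: "nat \<Rightarrow> real set"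
    where N: "\<forall>n. nowhere_dense (N n)" "- R \<subseteq> (\<Union>n. N n)"
    by (elim exE conjE)
  \<comment> \<open>The oscillation bound compares \<open>f\<close> at points of \<open>R\<close>;
    \<open>S_J\<close> handles pairs that may lie outside \<open>R\<close>; the length bound keeps
    all points of a gap close to every \<open>F j\<close> that the gap is near.\<close>
  define P where "P n l u \<longleftrightarrow> (\<forall>x\<in>R \<inter> {l<..<u}. \<forall>y\<in>R \<inter> {l<..<u}. \<bar>f x - f y\<bar> \<le> (1/2)^n) \<and>
      S_J {l<..<u} R ((1/2)^n) f \<and> u - l < 1 / real (Suc n)" for n l u
  have "\<exists>F :: nat \<Rightarrow> real set. (\<forall>n. closed (F n) \<and> nowhere_dense (F n) \<and> N n \<subseteq> F n \<and> F n \<subseteq> F (Suc n) \<and>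
           (\<forall>x. x \<notin> F n \<longrightarrow> (\<exists>l u. gap (F n) l u \<and> l < x \<and> x < u \<and> P n l u)))"
  proof (rule ex_gap_sequence)
    fix n and a b :: real assume "a < b"
    then have "a < min b (a + 1 / real (Suc n))" by simp
    from dense[OF this] obtain c where c: "a < c" "c < min b (a + 1 / real (Suc n))" by blast
    obtain l1 u1 where 1: "a \<le> l1" "l1 < u1" "u1 \<le> c"
        "\<forall>x\<in>R \<inter> {l1<..<u1}. \<forall>y\<in>R \<inter> {l1<..<u1}. \<bar>f x - f y\<bar> \<le> (1/2)^n"
      using continuous_on_residual_oscillation[OF R, of "(1/2)^n" a c] c(1) by auto
    obtain l u where 2: "l1 \<le> l" "l < u" "u \<le> u1" "S_J {l<..<u} R ((1/2)^n) f"
      using S[OF R(1), of "(1/2)^n", unfolded S_prop_iff, rule_format, OF _ 1(2)] by auto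
    have "{l<..<u} \<subseteq> {l1<..<u1}" using 2 by auto
    then have "P n l u" unfolding P_def using 1 2 c by auto
    with 1 2 c show "\<exists>l u. a \<le> l \<and> l < u \<and> u \<le> b \<and> P n l u"
      by (intro exI[of _ l] exI[of _ u]) auto
  next
    fix n l u l' u' assume P: "P n l u" and le: "l \<le> l'" "u' \<le> u"
    have sub: "{l'<..<u'} \<subseteq> {l<..<u}" using le by auto
    from P S_J_mono[OF _ sub] have "S_J {l'<..<u'} R ((1/2)^n) f" unfolding P_def by blast
    moreover from P le have "u' - l' < 1 / real (Suc n)" unfolding P_def by linarith
    ultimately show "P n l' u'" using P sub unfolding P_def by blast
  qed (rule N(1)[rule_format])
  then obtain F :: "nat \<Rightarrow> real set" where F: "\<And>n. closed (F n)" "\<And>n. nowhere_dense (F n)" "\<And>n. N n \<subseteq> F n"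
      "\<And>n. F n \<subseteq> F (Suc n)"
    and gapF: "\<And>n x. x \<notin> F n \<Longrightarrow> \<exists>l u. gap (F n) l u \<and> l < x \<and> x < u \<and> P n l u"
    by blast
  note Fmono = lift_Suc_mono_le[of F, OF F(4)]
  have gapP: "P n l u" if g: "gap (F n) l u" for n l u
  proof -
    have "l < u" using g by (simp add: gap_def)
    from dense[OF this] obtain x where x: "l < x" "x < u" by blast
    then have "x \<notin> F n" using g unfolding gap_def by auto
    then obtain l' u' where lu': "gap (F n) l' u'" "l' < x" "x < u'" "P n l' u'" using gapF by blast
    then have "x \<in> {l<..<u} \<inter> {l'<..<u'}" using x by auto
    then show ?thesis using gap_unique[OF g lu'(1)] lu'(4) by blast
  qed
  \<comment> \<open>\<open>f (r l u)\<close> will be the centre of the values used on the gap;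
    taking the point in \<open>R\<close> makes the oscillation bound apply to it.\<close>
  define r where "r l u = (SOME t. t \<in> R \<and> l < t \<and> t < u)" for l u
  have r: "r l u \<in> R" "l < r l u" "r l u < u" if "l < u" for l u
  proof -
    have "\<exists>t. t \<in> R \<and> l < t \<and> t < u" using residual_dense[OF R(1) that] by blast
    from someI_ex[OF this] show "r l u \<in> R" "l < r l u" "r l u < u" by (simp_all add: r_def)
  qed

  \<comment> \<open>The level of a gap of \<open>F n\<close> is the first \<open>j\<close> such that the gap is \<open>1/(n+1)\<close>-close to \<open>F j\<close>.
    The amplitude used there must beat the oscillation of \<open>f\<close> on the gaps of \<open>F (j - 1)\<close>, and it
    vanishes along the levels, which tend to infinity at a point outside all \<open>F j\<close>.\<close>
  define near where "near n l u j \<longleftrightarrow> (\<exists>p\<in>F j. \<exists>y\<in>{l<..<u}. \<bar>p - y\<bar> < 1 / real (Suc n))" for n l u j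
  define lev where "lev n l u = (LEAST j. near n l u j)" for n l u
  \<comment> \<open>The end-point \<open>l\<close> belongs to \<open>F n\<close>, so the level
    exists and is at most \<open>n\<close>.\<close>
  have near_self: "near n l u n" if g: "gap (F n) l u" for n l u
  proof -
    have "l < min u (l + 1 / real (Suc n))" using g by (simp add: gap_def)
    from dense[OF this] obtain y where "l < y" "y < min u (l + 1 / real (Suc n))" by blast
    then show ?thesis using g unfolding near_def gap_def by (intro bexI[of _ l] bexI[of _ y]) auto
  qed
  have lev_near: "near n l u (lev n l u)" and lev_le: "lev n l u \<le> n" if "gap (F n) l u" for n l u
    unfolding lev_def using near_self[OF that] by (rule LeastI, rule Least_le)
  have lev_leI: "lev n l u \<le> j" if "near n l u j" for n l u j
    unfolding lev_def using that by (rule Least_le)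

  \<comment> \<open>With \<open>e = (1/2)^k\<close>, the factor 8 gives
    \<open>rad (Suc k) = 4 * e\<close>. This exceeds the \<open>2 * e\<close> arising when
    \<open>a\<close> and \<open>b\<close> both lie in \<open>F n\<close>, and also
    \<open>rad (Suc (Suc k)) + e = 3 * e\<close>, arising when one of them lies in a gap of higher
    level.\<close>
  define rad where "rad j = 8 * (1/2 :: real) ^ j" for j :: nat
  have rad_pos: "rad j > 0" for j by (simp add: rad_def)
  \<comment> \<open>Nothing is known about \<open>f\<close> across points of \<open>F 0\<close>, hence the unbounded oscillation at level 0.\<close>
  define K where "K n l u = (if lev n l u = 0 then UNIV
      else {f (r l u) - rad (lev n l u)<..<f (r l u) + rad (lev n l u)})" for n l u
  define h where "h n l u = (SOME h. continuous_on {l<..<u} h \<and>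
      (\<forall>c\<in>{l<..<u}. h ` {l<..<c} = K n l u \<and> h ` {c<..<u} = K n l u))" for n l u
  have h: "continuous_on {l<..<u} (h n l u) \<and>
      (\<forall>c\<in>{l<..<u}. h n l u ` {l<..<c} = K n l u \<and> h n l u ` {c<..<u} = K n l u)" if "l < u" for n l u
  proof -
    have "K n l u = UNIV \<or> (\<exists>v r. r > 0 \<and> K n l u = {v - r<..<v + r})"
      unfolding K_def using rad_pos by auto
    from someI_ex[OF oscillating_function[OF that this]] show ?thesis unfolding h_def .
  qed
  have hcont: "continuous_on {l<..<u} (h n l u)" if "l < u" for n l u
    using h[OF that] by blast
  have himg: "h n l u ` {l<..<c} = K n l u \<and> h n l u ` {c<..<u} = K n l u" if "c \<in> {l<..<u}" for n l u c
    using h[of l u n] that by auto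
  have hK: "h n l u x \<in> K n l u" if "x \<in> {l<..<u}" for n l u x
  proof -
    have "x < u" using that by simp
    from dense[OF this] obtain c where c: "x < c" "c < u" by blast
    then have "h n l u ` {l<..<c} = K n l u" using himg[of c l u n] that by auto
    with c that show ?thesis by auto
  qed
  define g where "g n = glue (F n) f (h n)" for n

  have "swiatkowski (g n)" for n
    unfolding g_def
  proof (rule swiatkowski_glue[where K = "K n"])
    fix a b p assume "a < b" and p: "a \<le> p" "p \<le> b" "p \<in> F n" and "glue (F n) f (h n) a \<noteq> glue (F n) f (h n) b"
    then have ne: "g n a \<noteq> g n b" by (simp add: g_def)
    define meets where "meets l u \<longleftrightarrow> gap (F n) l u \<and> {l<..<u} \<inter> {a<..<b} \<noteq> {}" for l u
    have ex_meets: "\<exists>l u y. meets l u \<and> c < y \<and> y < d \<and> l < y \<and> y < u" if cd: "c < d" "a \<le> c" "d \<le> b" for c d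
    proof -
      obtain c' d' where cd': "c \<le> c'" "c' < d'" "d' \<le> d" "{c'<..<d'} \<inter> F n = {}"
        using F(2)[of n, unfolded nowhere_dense_iff, rule_format, OF cd(1)] by blast
      from dense[OF cd'(2)] obtain y where y: "c' < y" "y < d'" by blast
      then have "y \<notin> F n" using cd'(4) by auto
      then obtain l u where "gap (F n) l u" "l < y" "y < u" using gapF by blast
      moreover have "y \<in> {a<..<b}" using y cd cd' by auto
      ultimately show ?thesis using y cd' unfolding meets_def
        by (intro exI[of _ l] exI[of _ u] exI[of _ y]) auto
    qed
    \<comment> \<open>By minimality of the level \<open>j = Suc k\<close>, the points \<open>a\<close> and \<open>b\<close> lie in a common gap of \<open>F k\<close>,
      while a gap of level \<open>j\<close> between them carries amplitude \<open>4 * (1/2)^k\<close>.\<close>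
    define j where "j = (LEAST j. \<exists>l u. meets l u \<and> lev n l u = j)"
    have "\<exists>j l u. meets l u \<and> lev n l u = j" using ex_meets[OF \<open>a < b\<close>] by blast
    then have "\<exists>l u. meets l u \<and> lev n l u = j" unfolding j_def by (rule LeastI_ex)
    then obtain l u where lu: "meets l u" "lev n l u = j" by blast
    have jmin: "j \<le> lev n l' u'" if "meets l' u'" for l' u'
      unfolding j_def using that by (intro Least_le) blast
    have "\<exists>l u. meets l u \<and> (\<exists>y\<in>K n l u. min (g n a) (g n b) < y \<and> y < max (g n a) (g n b))"
    proof (cases j)
      case 0
      then have "K n l u = UNIV" using lu(2) by (simp add: K_def)
      moreover have "min (g n a) (g n b) < (g n a + g n b) / 2" "(g n a + g n b) / 2 < max (g n a) (g n b)"
        using ne by auto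
      ultimately show ?thesis using lu(1) by blast
    next
      case (Suc k)
      define e where "e = (1/2 :: real) ^ k"
      have "e > 0" by (simp add: e_def)
      have radj: "rad j = 4 * e" by (simp add: rad_def e_def Suc)
      \<comment> \<open>Otherwise some gap meeting \<open>{a<..<b}\<close> would come within
        \<open>1/(n+1)\<close> of \<open>q\<close>, and its level would be at most \<open>k\<close>,
        below the minimal level \<open>j\<close>.\<close>
      have far: "q \<notin> F k" if q: "a \<le> q" "q \<le> b" for q
      proof
        assume "q \<in> F k"
        have "1 / real (Suc n) > 0" by simp
        then have "max a (q - 1 / real (Suc n)) < min b (q + 1 / real (Suc n))"
          using q \<open>a < b\<close> unfolding max_less_iff_conj min_less_iff_conj by linarith
        from ex_meets[OF this] obtain l' u' y where y: "meets l' u'" "max a (q - 1 / real (Suc n)) < y"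
            "y < min b (q + 1 / real (Suc n))" "l' < y" "y < u'"
          by auto
        then have "near n l' u' k"
          using \<open>q \<in> F k\<close> unfolding near_def by (intro bexI[of _ q] bexI[of _ y]) auto
        then have "lev n l' u' \<le> k" by (rule lev_leI)
        with jmin[OF y(1)] Suc show False by simp
      qed
      have "k < n" using lev_le[of n l u] lu Suc unfolding meets_def by auto
      then have FkFn: "F k \<subseteq> F n" using Fmono by simp
      have "a \<notin> F k" using far \<open>a < b\<close> by simp
      then obtain L U where LU: "gap (F k) L U" "L < a" "a < U" "P k L U" using gapF by blast
      have "b < U"
      proof (rule ccontr)
        assume "\<not> b < U"
        then have "U \<notin> F k" using far LU(3) by simp
        with LU(1) show False by (simp add: gap_def)
      qed
      \<comment> \<open>\<open>L\<close> and \<open>U\<close> lie in \<open>F k\<close>, hence in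
        \<open>F n\<close>, so no gap of \<open>F n\<close> contains them.\<close>
      have inside: "L \<le> l' \<and> u' \<le> U" if m: "meets l' u'" for l' u'
      proof -
        obtain z where z: "l' < z" "z < u'" "a < z" "z < b"
          using m unfolding meets_def disjoint_iff greaterThanLessThan_iff by blast
        have "L \<in> F n" "U \<in> F n" using LU(1) FkFn by (auto simp: gap_def)
        then have "L \<notin> {l'<..<u'}" "U \<notin> {l'<..<u'}" using m unfolding meets_def gap_def by blast+
        then show ?thesis using z LU(2) \<open>b < U\<close> by auto
      qed
      have ref: "r l' u' \<in> R \<inter> {L<..<U}" if m: "meets l' u'" for l' u'
        using inside[OF m] r[of l' u'] m unfolding meets_def gap_def by auto
      have osc: "\<bar>f x - f y\<bar> \<le> e" if "x \<in> R \<inter> {L<..<U}" "y \<in> R \<inter> {L<..<U}" for x y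
        using LU(4) that unfolding P_def e_def by blast
      have SJ: "S_J {L<..<U} R e f" using LU(4) unfolding P_def e_def by blast
      have Kball: "K n l' u' = {f (r l' u') - 4 * e<..<f (r l' u') + 4 * e}"
        if "meets l' u'" "lev n l' u' = j" for l' u'
        using that radj Suc by (simp add: K_def)
      show ?thesis
      proof (cases "a \<in> F n \<and> b \<in> F n")
        case True
        then have gab: "g n a = f a" "g n b = f b" by (simp_all add: g_def glue_on_set)
        have ab: "a \<in> {L<..<U}" "b \<in> {L<..<U}" using LU \<open>b < U\<close> \<open>a < b\<close> by auto
        \<comment> \<open>Outside \<open>R\<close> the oscillation bound says nothing about
          \<open>f a\<close> and \<open>f b\<close>. \<open>SJ\<close> supplies \<open>x\<close> in
          \<open>R\<close> with \<open>f x\<close> within \<open>e\<close> of the range between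
          them, so \<open>f (r l u)\<close> is within \<open>2 * e\<close> of it.\<close>
        have "\<exists>x\<in>R \<inter> open_interval a b. min (f a) (f b) - e < f x \<and> f x < max (f a) (f b) + e"
        proof (cases "f a < f b")
          case True
          then show ?thesis using SJ ab unfolding S_J_def by (simp add: min_def max_def)
        next
          case False
          then have "f b < f a" using ne gab by simp
          then have "\<exists>x\<in>R \<inter> open_interval b a. f b - e < f x \<and> f x < f a + e"
            using SJ ab unfolding S_J_def by blast
          moreover have "open_interval b a = open_interval a b"
            by (simp add: open_interval_def min.commute max.commute)
          ultimately show ?thesis using \<open>f b < f a\<close> by (simp add: min_def max_def)
        qed
        then obtain x where x: "x \<in> R" "x \<in> open_interval a b"
          "min (f a) (f b) - e < f x" "f x < max (f a) (f b) + e" by blast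
        have "x \<in> {L<..<U}" using x(2) ab by (auto simp: open_interval_def)
        then have "\<bar>f x - f (r l u)\<bar> \<le> e" using osc ref[OF lu(1)] x(1) by blast
        then have "max (min (f a) (f b)) (f (r l u) - 4 * e) < min (max (f a) (f b)) (f (r l u) + 4 * e)"
          using x(3,4) \<open>e > 0\<close> ne gab by (simp add: abs_le_iff)
        from dense[OF this] obtain y where
          "max (min (f a) (f b)) (f (r l u) - 4 * e) < y" "y < min (max (f a) (f b)) (f (r l u) + 4 * e)"
          by blast
        then show ?thesis
          using lu(1) Kball[OF lu] gab by (intro exI[of _ l] exI[of _ u] conjI bexI[of _ y]) auto
      next
        case False
        then obtain c d where c: "c \<notin> F n" "{c, d} = {a, b}" by blast
        have "c \<in> {a, b}" using c(2) by blast
        have mm: "min (g n a) (g n b) = min (g n c) (g n d)" "max (g n a) (g n b) = max (g n c) (g n d)"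
          and cd: "g n c \<noteq> g n d"
          using c(2) ne by (auto simp: doubleton_eq_iff min.commute max.commute)
        obtain l' u' where lu': "gap (F n) l' u'" "l' < c" "c < u'" using gapF c(1) by blast
        have "max l' a < min u' b" using lu' \<open>c \<in> {a, b}\<close> \<open>a < b\<close> by auto
        from dense[OF this] obtain z where "max l' a < z" "z < min u' b" by blast
        then have "z \<in> {l'<..<u'} \<inter> {a<..<b}" by simp
        then have m: "meets l' u'" unfolding meets_def using lu'(1) by blast
        have gc: "g n c \<in> K n l' u'" using hK[of c l' u' n] glue_on_gap[OF lu'(1), of c f "h n"] lu' by (simp add: g_def)
        \<comment> \<open>If the gap around \<open>c\<close> has level above \<open>j\<close>, its
          amplitude is at most \<open>2 * e\<close>; adding the oscillation \<open>e\<close> between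
          reference points leaves \<open>g n c\<close> among the values of a gap of level
          \<open>j\<close>.\<close>
        have "\<exists>l u. meets l u \<and> lev n l u = j \<and> \<bar>g n c - f (r l u)\<bar> < 4 * e"
        proof (cases "lev n l' u' = j")
          case True
          then show ?thesis using gc Kball[OF m True] m by (intro exI[of _ l'] exI[of _ u']) auto
        next
          case False
          then have "Suc j \<le> lev n l' u'" using jmin[OF m] by simp
          then have "rad (lev n l' u') \<le> rad (Suc j)" unfolding rad_def
            by (intro mult_left_mono power_decreasing) auto
          also have "\<dots> = 2 * e" using radj by (simp add: rad_def)
          finally have "\<bar>g n c - f (r l' u')\<bar> < 2 * e"
            using gc \<open>Suc j \<le> lev n l' u'\<close> by (auto simp: K_def)
          moreover have "\<bar>f (r l' u') - f (r l u)\<bar> \<le> e" using osc ref m lu(1) by blast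
          ultimately have "\<bar>g n c - f (r l u)\<bar> < 4 * e" using \<open>e > 0\<close> by linarith
          then show ?thesis using lu by blast
        qed
        then obtain l0 u0 where lu0: "meets l0 u0" "lev n l0 u0 = j" "\<bar>g n c - f (r l0 u0)\<bar> < 4 * e" by blast
        show ?thesis
          unfolding mm using interval_values_meet[OF lu0(3) cd] Kball[OF lu0(1,2)] lu0(1) by auto
      qed
    qed
    then show "\<exists>l u. gap (F n) l u \<and> {l<..<u} \<inter> {a<..<b} \<noteq> {} \<and>
        (\<exists>y\<in>K n l u. min (glue (F n) f (h n) a) (glue (F n) f (h n) b) < y \<and>
           y < max (glue (F n) f (h n) a) (glue (F n) f (h n) b))"
      unfolding meets_def g_def by blast
  next
    show "\<exists>l u. gap (F n) l u \<and> l < x \<and> x < u" if "x \<notin> F n" for x using gapF[OF that] by blast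
    show "continuous_on {l<..<u} (h n l u)" if "gap (F n) l u" for l u
      using hcont that by (simp add: gap_def)
    show "h n l u ` {l<..<c} = K n l u \<and> h n l u ` {c<..<u} = K n l u" if "c \<in> {l<..<u}" for l u c
      by (rule himg[OF that])
  qed (rule F(2))
  moreover have "(\<lambda>n. g n x) \<longlonglongrightarrow> f x" for x
  proof (cases "\<exists>m. x \<in> F m")
    case True
    then obtain m where "x \<in> F m" by blast
    then have "g n x = f x" if "n \<ge> m" for n using Fmono[OF that] by (auto simp: g_def glue_on_set)
    then show ?thesis by (intro tendsto_eventually eventually_sequentiallyI)
  next
    case False
    then have "x \<in> R" using N(2) F(3) by blast
    show ?thesis
    proof (rule LIMSEQ_I)
      fix d :: real assume "d > 0"
      \<comment> \<open>The final error is below \<open>8 * (1/2)^j\<close> from the amplitude plus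
        \<open>(1/2)^n\<close> from the oscillation, hence the 9.\<close>
      then obtain j where j: "(1/2 :: real) ^ j < d / 9"
        using real_arch_pow_inv[of "d / 9" "1/2 :: real"] by auto
      have "open (- F j)" "x \<in> - F j" using F(1)[of j] False by auto
      then obtain s where s: "s > 0" "ball x s \<subseteq> - F j" by (rule openE)
      obtain n0 where n0: "inverse (real (Suc n0)) < s / 2" using reals_Archimedean[of "s / 2"] s(1) by auto
      show "\<exists>no. \<forall>n\<ge>no. norm (g n x - f x) < d"
      proof (intro exI[of _ "max j n0"] allI impI)
        fix n assume n: "max j n0 \<le> n"
        have "1 / real (Suc n) \<le> inverse (real (Suc n0))" using n by (simp add: field_simps)
        then have small: "1 / real (Suc n) < s / 2" using n0 by linarith
        obtain l u where lu: "gap (F n) l u" "l < x" "x < u" "P n l u" using gapF False by blast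
        \<comment> \<open>The gap is shorter than \<open>1/(n+1)\<close> and comes within that
          distance of \<open>F (lev n l u)\<close>, so \<open>x\<close> is less than
          \<open>s\<close> away from this set; a subset of \<open>F j\<close> is not that
          close.\<close>
        have "j < lev n l u"
        proof (rule ccontr)
          assume "\<not> j < lev n l u"
          then have "F (lev n l u) \<subseteq> F j" using Fmono by simp
          with lev_near[OF lu(1)] obtain p y where "p \<in> F j" "y \<in> {l<..<u}" "\<bar>p - y\<bar> < 1 / real (Suc n)"
            unfolding near_def by blast
          moreover have "u - l < 1 / real (Suc n)" using lu(4) unfolding P_def by blast
          ultimately have "dist x p < s" "p \<in> F j"
            using small lu(2,3) unfolding dist_real_def greaterThanLessThan_iff by linarith+
          with s(2) show False by (auto simp: subset_iff)
        qed
        have "g n x \<in> K n l u" using hK[of x l u n] glue_on_gap[OF lu(1), of x f "h n"] lu by (simp add: g_def)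
        then have "\<bar>g n x - f (r l u)\<bar> < rad (lev n l u)"
          using \<open>j < lev n l u\<close> by (auto simp: K_def)
        also have "\<dots> \<le> rad j" unfolding rad_def using \<open>j < lev n l u\<close>
          by (intro mult_left_mono power_decreasing) auto
        finally have "\<bar>g n x - f (r l u)\<bar> < 8 * (1/2) ^ j" by (simp add: rad_def)
        moreover have "\<bar>f (r l u) - f x\<bar> \<le> (1/2) ^ n"
          using lu(4) r[of l u] lu(2,3) \<open>x \<in> R\<close> unfolding P_def by auto
        moreover have "(1/2 :: real) ^ n \<le> (1/2) ^ j" using n by (intro power_decreasing) auto
        ultimately show "norm (g n x - f x) < d" using j unfolding real_norm_def by linarith
      qed
    qed
  qed
  ultimately show "f \<in> LIMf Swiat_class" unfolding LIMf_def Swiat_class_def by blast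
qed

subsection \<open>The Baire hierarchy\<close>

lemma LIMf_mono: "F \<subseteq> G \<Longrightarrow> LIMf F \<subseteq> LIMf G"
  unfolding LIMf_def by blast

lemma subset_LIMf: "F \<subseteq> LIMf F"
  unfolding LIMf_def by (auto intro!: exI[of _ "\<lambda>_. _"])

lemma LIMf_Swiat_eq: "LIMf Swiat_class = frakS"
  using LIMf_Swiat_subset frakS_subset_LIMf by blast

lemma LIMf_Baire_subset: "LIMf {f. has_Baire_property f} \<subseteq> {f. has_Baire_property f}"
proof
  fix g assume "g \<in> LIMf {f. has_Baire_property f}"
  then obtain f where f: "\<And>n::nat. has_Baire_property (f n)" and lim: "\<And>x. (\<lambda>n. f n x) \<longlonglongrightarrow> g x"
    unfolding LIMf_def by blast
  show "g \<in> {f. has_Baire_property f}"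
    using has_Baire_property_limit[of f, OF f lim] by simp
qed

lemma frakS_subset_Baire: "frakS \<subseteq> {f. has_Baire_property f}"
  by (auto simp: frakS_def)

lemma Swiat_subset_frakS: "Swiat_class \<subseteq> frakS"
  using subset_LIMf[of Swiat_class] LIMf_Swiat_eq by simp

text \<open>Inside a gap the function is constant, so it is continuous on \<open>- F\<close>, and
  the premise \<open>f a < f b\<close> of \<open>S_J\<close> never holds there.\<close>

lemma glue_const_in_frakS:
  assumes F: "nowhere_dense F" "\<And>x. x \<notin> F \<Longrightarrow> \<exists>l u. gap F l u \<and> l < x \<and> x < u"
  shows "glue F f (\<lambda>l u x. v l u) \<in> frakS"
proof -
  define g where "g = glue F f (\<lambda>l u x. v l u)"
  have eq: "g x = v l u" if "gap F l u" "x \<in> {l<..<u}" for l u x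
    using glue_on_gap[OF that] by (simp add: g_def)
  have "residual (- F)"
    using F(1) by (simp add: residual_def nowhere_dense_imp_meager)
  moreover have "continuous_on (- F) g"
  proof (rule continuous_at_imp_continuous_on, rule ballI)
    fix x assume "x \<in> - F"
    then obtain l u where lu: "gap F l u" "l < x" "x < u" using F(2) by blast
    have "continuous_on {l<..<u} g"
      unfolding g_def by (rule continuous_on_glue_gap[OF lu(1)]) simp
    with lu show "isCont g x" by (simp add: continuous_on_eq_continuous_at)
  qed
  ultimately have "has_Baire_property g" unfolding has_Baire_property_iff by blast
  moreover have "S_prop A e g" for A e
    unfolding S_prop_iff
  proof (intro allI impI)
    fix a b :: real assume "a < b"
    obtain c d where cd: "a \<le> c" "c < d" "d \<le> b" "{c<..<d} \<inter> F = {}"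
      using F(1)[unfolded nowhere_dense_iff, rule_format, OF \<open>a < b\<close>] by blast
    from dense[OF cd(2)] obtain x where x: "c < x" "x < d" by blast
    then have "x \<notin> F" using cd(4) by auto
    then obtain l u where lu: "gap F l u" "l < x" "x < u" using F(2) by blast
    have "g y = g z" if "y \<in> {max c l<..<min d u}" "z \<in> {max c l<..<min d u}" for y z
      using eq[OF lu(1), of y] eq[OF lu(1), of z] that by simp
    then have "S_J {max c l<..<min d u} A e g" unfolding S_J_def by (metis less_irrefl)
    then show "\<exists>l u. a \<le> l \<and> l < u \<and> u \<le> b \<and> S_J {l<..<u} A e g"
      using cd x lu by (intro exI[of _ "max c l"] exI[of _ "min d u"]) auto
  qed
  ultimately show ?thesis unfolding frakS_def g_def by blast
qed

text \<open>A point outside every \<open>F n\<close> belongs to \<open>R\<close> and shares a gap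
  with a reference point of \<open>R\<close>, so the error is at most \<open>(1/2)^n\<close>; at a
  point of some \<open>F m\<close> the sequence is eventually constant.\<close>

lemma Baire_subset_LIMf_frakS: "{f. has_Baire_property f} \<subseteq> LIMf frakS"
proof
  fix f assume "f \<in> {f. has_Baire_property f}"
  then obtain R where R: "residual R" "continuous_on R f" unfolding has_Baire_property_iff by blast
  from residual_cover[OF R(1)] obtain N :: "nat \<Rightarrow> real set"
    where N: "\<forall>n. nowhere_dense (N n)" "- R \<subseteq> (\<Union>n. N n)"
    by (elim exE conjE)
  define P where "P n l u \<longleftrightarrow> (\<forall>x\<in>R \<inter> {l<..<u}. \<forall>y\<in>R \<inter> {l<..<u}. \<bar>f x - f y\<bar> \<le> (1/2)^n)" for n :: nat and l u
  have "\<exists>F :: nat \<Rightarrow> real set. (\<forall>n. closed (F n) \<and> nowhere_dense (F n) \<and> N n \<subseteq> F n \<and> F n \<subseteq> F (Suc n) \<and>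
           (\<forall>x. x \<notin> F n \<longrightarrow> (\<exists>l u. gap (F n) l u \<and> l < x \<and> x < u \<and> P n l u)))"
  proof (rule ex_gap_sequence)
    fix n and a b :: real assume "a < b"
    then show "\<exists>l u. a \<le> l \<and> l < u \<and> u \<le> b \<and> P n l u"
      unfolding P_def by (intro continuous_on_residual_oscillation R) auto
  next
    fix n l u l' u' assume P: "P n l u" and le: "l \<le> l'" "u' \<le> u"
    have sub: "{l'<..<u'} \<subseteq> {l<..<u}" using le by auto
    with P show "P n l' u'" unfolding P_def by blast
  qed (rule N(1)[rule_format])
  then obtain F :: "nat \<Rightarrow> real set" where F: "\<And>n. closed (F n)" "\<And>n. nowhere_dense (F n)" "\<And>n. N n \<subseteq> F n"
      "\<And>n. F n \<subseteq> F (Suc n)"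
    and gapF: "\<And>n x. x \<notin> F n \<Longrightarrow> \<exists>l u. gap (F n) l u \<and> l < x \<and> x < u \<and> P n l u"
    by blast
  note Fmono = lift_Suc_mono_le[of F, OF F(4)]
  define r where "r l u = (SOME t. t \<in> R \<and> l < t \<and> t < u)" for l u
  have r: "r l u \<in> R \<inter> {l<..<u}" if "l < u" for l u
  proof -
    have "\<exists>t. t \<in> R \<and> l < t \<and> t < u" using residual_dense[OF R(1) that] by blast
    from someI_ex[OF this] show "r l u \<in> R \<inter> {l<..<u}" by (simp add: r_def)
  qed
  define g where "g n = glue (F n) f (\<lambda>l u x. f (r l u))" for n
  have "g n \<in> frakS" for n
    unfolding g_def by (rule glue_const_in_frakS[OF F(2)]) (use gapF in blast)
  moreover have "(\<lambda>n. g n x) \<longlonglongrightarrow> f x" for x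
  proof (cases "\<exists>m. x \<in> F m")
    case True
    then obtain m where "x \<in> F m" by blast
    then have "g n x = f x" if "n \<ge> m" for n using Fmono[OF that] by (auto simp: g_def glue_on_set)
    then show ?thesis by (intro tendsto_eventually eventually_sequentiallyI)
  next
    case False
    then have "x \<in> R" using N(2) F(3) by blast
    have "\<bar>g n x - f x\<bar> \<le> (1/2) ^ n" for n
    proof -
      obtain l u where lu: "gap (F n) l u" "l < x" "x < u" "P n l u" using gapF False by blast
      then have "g n x = f (r l u)" unfolding g_def by (intro glue_on_gap) auto
      with lu r[of l u] \<open>x \<in> R\<close> show ?thesis unfolding P_def by auto
    qed
    then have "(\<lambda>n. g n x - f x) \<longlonglongrightarrow> 0"
      by (intro Lim_null_comparison[OF _ LIMSEQ_realpow_zero[of "1/2 :: real"]]) auto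
    then show ?thesis by (rule LIM_zero_cancel)
  qed
  ultimately show "f \<in> LIMf frakS" unfolding LIMf_def by blast
qed

text \<open>\<open>LIMf\<close> sends both ends of this range to the same class, which settles all
  stages above 1 at once.\<close>

lemma LIMf_eq_Baire:
  assumes "frakS \<subseteq> F" "F \<subseteq> {f. has_Baire_property f}"
  shows "LIMf F = {f. has_Baire_property f}"
  using LIMf_mono[OF assms(1)] LIMf_mono[OF assms(2)] LIMf_Baire_subset Baire_subset_LIMf_frakS
  by blast

section \<open>The transfinite stages\<close>

lemma Bhier_eq:
  assumes "Well_order r"
  shows "Bhier F r a = (if (\<forall>b. (b, a) \<notin> r - Id) then F else LIMf (\<Union>{Bhier F r b | b. (b, a) \<in> r - Id}))"
proof -
  have "wf (r - Id)" using assms by (simp add: well_order_on_def)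
  \<comment> \<open>The recursion only inspects strict predecessors of \<open>a\<close>, where
    \<open>cut\<close> changes nothing.\<close>
  have "{cut (Bhier F r) (r - Id) a b | b. (b, a) \<in> r - Id} = {Bhier F r b | b. (b, a) \<in> r - Id}"
    by (auto simp: cut_def)
  with def_wfrec[OF Bhier_def[THEN eq_reflection] \<open>wf (r - Id)\<close>, of F a] show ?thesis by simp blast
qed

text \<open>Well-founded induction: a stage with a predecessor is the limit class of a union
  containing \<open>Swiat_class\<close>, hence contains \<open>frakS\<close>, and the Baire property
  survives limits.\<close>

lemma Bhier_Swiat_bounds:
  assumes "Well_order r"
  shows "Swiat_class \<subseteq> Bhier Swiat_class r a \<and> Bhier Swiat_class r a \<subseteq> {f. has_Baire_property f} \<and>
    ((\<exists>b. (b, a) \<in> r - Id) \<longrightarrow> frakS \<subseteq> Bhier Swiat_class r a)"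
proof -
  have "wf (r - Id)" using assms by (simp add: well_order_on_def)
  then show ?thesis
  proof (induction a rule: wf_induct_rule)
    case (less a)
    show ?case
    proof (cases "\<forall>b. (b, a) \<notin> r - Id")
      case True
      then have "Bhier Swiat_class r a = Swiat_class" using Bhier_eq[OF assms, of Swiat_class a] by simp
      with True Swiat_subset_frakS frakS_subset_Baire show ?thesis by auto
    next
      case False
      then obtain b where b: "(b, a) \<in> r - Id" by blast
      define U where "U = \<Union>{Bhier Swiat_class r b | b. (b, a) \<in> r - Id}"
      have eq: "Bhier Swiat_class r a = LIMf U"
        unfolding U_def by (subst Bhier_eq[OF assms]) (simp only: False if_False)
      have "Swiat_class \<subseteq> U" using less[OF b] b unfolding U_def by blast
      moreover have "U \<subseteq> {f. has_Baire_property f}" using less unfolding U_def by blast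
      ultimately show ?thesis
        unfolding eq using LIMf_mono[of Swiat_class U] LIMf_mono[of U "{f. has_Baire_property f}"]
          LIMf_Swiat_eq Swiat_subset_frakS LIMf_Baire_subset by blast
    qed
  qed
qed

text \<open>Of two strict predecessors of \<open>a\<close> the larger has a predecessor itself, so
  its stage contains \<open>frakS\<close>. Infinity is listed separately because \<open>card\<close>
  is then 0.\<close>

lemma Bhier_Swiat_eq_Baire:
  assumes r: "Well_order r"
    and two: "infinite {b. (b, a) \<in> r - Id} \<or> 2 \<le> card {b. (b, a) \<in> r - Id}"
  shows "Bhier Swiat_class r a = {f. has_Baire_property f}"
proof -
  have "\<not> (\<exists>b. {b. (b, a) \<in> r - Id} \<subseteq> {b})"
  proof
    assume "\<exists>b. {b. (b, a) \<in> r - Id} \<subseteq> {b}"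
    then obtain b where "{b. (b, a) \<in> r - Id} \<subseteq> {b}" by blast
    then have "finite {b. (b, a) \<in> r - Id}" "card {b. (b, a) \<in> r - Id} \<le> card {b}"
      by (rule finite_subset, simp, intro card_mono) auto
    with two show False by simp
  qed
  then obtain x y where xy: "(x, a) \<in> r - Id" "(y, a) \<in> r - Id" "x \<noteq> y" by blast
  then have "x \<in> Field r" "y \<in> Field r" by (auto simp: Field_def)
  then have "(x, y) \<in> r \<or> (y, x) \<in> r"
    using r xy(3) by (simp add: well_order_on_def linear_order_on_def total_on_def)
  then obtain b c where bc: "(b, a) \<in> r - Id" "(c, b) \<in> r - Id" using xy by blast
  define U where "U = \<Union>{Bhier Swiat_class r b | b. (b, a) \<in> r - Id}"
  have "Bhier Swiat_class r a = LIMf U"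
    using Bhier_eq[OF r, of Swiat_class a] bc(1) unfolding U_def by auto
  moreover have "frakS \<subseteq> U" using Bhier_Swiat_bounds[OF r, of b] bc unfolding U_def by blast
  moreover have "U \<subseteq> {f. has_Baire_property f}" using Bhier_Swiat_bounds[OF r] unfolding U_def by blast
  ultimately show ?thesis using LIMf_eq_Baire by simp
qed

text \<open>The indicator of \<open>{0}\<close> takes no value strictly between 0 and 1, but is
  constant on every interval avoiding 0.\<close>

lemma frakS_neq_Swiat_class: "frakS \<noteq> Swiat_class"
proof -
  define f where "f x = (if x = 0 then 1 else 0 :: real)" for x :: real
  have "\<not> swiatkowski f"
  proof
    assume "swiatkowski f"
    moreover have "(0::real) < 1 \<and> f 0 \<noteq> f 1" by (simp add: f_def)
    ultimately have "\<exists>x\<in>{0<..<1}. isCont f x \<and> min (f 0) (f 1) < f x \<and> f x < max (f 0) (f 1)"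
      unfolding swiatkowski_def by blast
    then show False by (auto simp: f_def)
  qed
  moreover have "has_Baire_property f"
  proof -
    have "residual (- {0})" by (rule residual_countable_compl) simp
    moreover have "continuous_on (- {0}) f"
      by (rule continuous_on_eq[of _ "\<lambda>_. 0"]) (auto simp: f_def)
    ultimately show ?thesis unfolding has_Baire_property_iff by blast
  qed
  moreover have "S_prop A e f" for A e
    unfolding S_prop_iff
  proof (intro allI impI)
    fix a b :: real assume "a < b"
    show "\<exists>l u. a \<le> l \<and> l < u \<and> u \<le> b \<and> S_J {l<..<u} A e f"
    proof (cases "0 \<le> a")
      case True
      with \<open>a < b\<close> show ?thesis by (intro exI[of _ a] exI[of _ b]) (auto simp: S_J_def f_def)
    next
      case False
      with \<open>a < b\<close> show ?thesis by (intro exI[of _ a] exI[of _ "min b 0"]) (auto simp: S_J_def f_def)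
    qed
  qed
  ultimately have "f \<in> frakS" "f \<notin> Swiat_class" by (auto simp: frakS_def Swiat_class_def)
  then show ?thesis by blast
qed

text \<open>The witness is 1 and 3 on two disjoint countable dense sets and 0 elsewhere. Off these
  sets, which is residually often, no value exceeds \<open>1 - 1/2\<close>.\<close>

lemma Baire_neq_frakS: "{f. has_Baire_property f} \<noteq> frakS"
proof -
  \<comment> \<open>Irrationality of \<open>t\<close> makes the rationals and their translate by
    \<open>t\<close> disjoint.\<close>
  obtain t :: real where t: "t \<notin> \<rat>"
    using residual_dense[OF residual_countable_compl[OF countable_rat], of 0 1] by auto
  define C where "C = \<rat> \<union> (\<lambda>x. x + t) ` (\<rat> :: real set)"
  define f where "f x = (if x \<in> \<rat> then 1 else if x \<in> C then 3 else 0 :: real)" for x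
  have "countable C" unfolding C_def by (intro countable_Un countable_image countable_rat)
  then have R: "residual (- C)" by (rule residual_countable_compl)
  have f0: "f x = 0" if "x \<in> - C" for x using that by (simp add: f_def C_def)
  have "continuous_on (- C) f"
    by (rule continuous_on_eq[of _ "\<lambda>_. 0"]) (auto simp: f0)
  with R have "has_Baire_property f" unfolding has_Baire_property_iff by blast
  moreover have "f \<notin> frakS"
  proof
    assume "f \<in> frakS"
    then have "S_prop (- C) (1/2) f" using R by (simp add: frakS_def)
    then obtain l u where lu: "l < u" "S_J {l<..<u} (- C) (1/2) f"
      unfolding S_prop_iff by (meson zero_less_one)
    obtain p where p: "p \<in> \<rat>" "l < p" "p < u" using Rats_dense_in_real[OF lu(1)] by blast
    obtain q where q: "q \<in> \<rat>" "l - t < q" "q < u - t"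
      using Rats_dense_in_real[of "l - t" "u - t"] lu(1) by auto
    have "q + t \<notin> \<rat>"
    proof
      assume "q + t \<in> \<rat>"
      then have "q + t - q \<in> \<rat>" using q(1) by (intro Rats_diff)
      with t show False by simp
    qed
    then have "f (q + t) = 3" using q(1) by (simp add: f_def C_def)
    moreover have "f p = 1" using p by (simp add: f_def)
    ultimately obtain x where "x \<in> - C" "f p - 1/2 < f x"
      using lu(2)[unfolded S_J_def, rule_format, of p "q + t"] p q by auto
    with f0[of x] \<open>f p = 1\<close> show False by simp
  qed
  ultimately show ?thesis by blast
qed

text \<open>Every ordinal below omega_1 is the order type of the strict predecessors of an element
  of a well-order on a set of naturals, so \<open>r\<close> and \<open>a\<close> reach all countable
  stages above 1.\<close>

theorem mainTheorem9:
  shows "Bnat Swiat_class 1 = frakS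
    \<and> (\<forall>(r :: (nat \<times> nat) set) a.
          Well_order r \<and> a \<in> Field r
          \<and> (infinite {b. (b, a) \<in> r - Id} \<or> 2 \<le> card {b. (b, a) \<in> r - Id})
        \<longrightarrow> Bhier Swiat_class r a = {f. has_Baire_property f})
    \<and> (Bnat Swiat_class 1 \<noteq> Bnat Swiat_class 0
       \<and> Bnat Swiat_class 2 \<noteq> Bnat Swiat_class 1
       \<and> Bnat Swiat_class 3 = Bnat Swiat_class 2)"
proof -
  let ?BP = "{f. has_Baire_property f}"
  have 1: "Bnat Swiat_class 1 = frakS" by (simp add: LIMf_Swiat_eq)
  have "(\<Union>k\<le>1. Bnat Swiat_class k) = Swiat_class \<union> frakS"
    using 1 by (auto simp: atMost_Suc)
  then have 2: "Bnat Swiat_class 2 = ?BP"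
    by (simp add: numeral_2_eq_2 sup_absorb2[OF Swiat_subset_frakS]
        LIMf_eq_Baire[OF order_refl frakS_subset_Baire])
  have "(\<Union>k\<le>2. Bnat Swiat_class k) = Swiat_class \<union> frakS \<union> ?BP"
    using 1 2 by (auto simp: atMost_Suc numeral_2_eq_2)
  then have 3: "Bnat Swiat_class 3 = ?BP"
    by (simp add: numeral_3_eq_3 numeral_2_eq_2 sup_absorb2[OF order_trans[OF Swiat_subset_frakS frakS_subset_Baire]]
        sup_absorb2[OF frakS_subset_Baire] sup_absorb2[OF Swiat_subset_frakS] LIMf_eq_Baire[OF frakS_subset_Baire order_refl])
  show ?thesis
  proof (intro conjI allI impI)
    show "Bnat Swiat_class 1 \<noteq> Bnat Swiat_class 0" using 1 frakS_neq_Swiat_class by simp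
    show "Bnat Swiat_class 2 \<noteq> Bnat Swiat_class 1" using 1 2 Baire_neq_frakS by simp
    show "Bnat Swiat_class 3 = Bnat Swiat_class 2" using 2 3 by simp
  qed (rule 1, elim conjE, rule Bhier_Swiat_eq_Baire)
qed

end
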